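(* Let $1<q<p<\infty$, let $\omega$ be a weight on $\mathcal H$ with $\omega\in B_p$, and let $\mu$ be a positive measure on $\mathcal H$. Then there exists a constant $C_1>0$ such that $$\left(\int_{\mathcal H}|M_\omega f(z)|^q\,d\mu(z)\right)^{1/q}\le C_1\|f\|_{p,\omega}\qquad\text{for any } f\in L^p_\omega(\mathcal H)$$ if and only if the function $$K_\mu(z):=\sup_{I\subset\mathbb R\ \text{interval},\ z\in Q_I}\frac{\mu(Q_I)}{\omega(Q_I)}$$ belongs to $L^s_\omega(\mathcal H)$, where $s=\frac{p}{p-q}$.
   Context: $\mathcal H=\{z=x+iy\in\mathbb C: x\in\mathbb R,\ y>0\}$ is the upper half-plane and $dV$ is Lebesgue measure on $\mathcal H$. A weight is a nonnegative locally integrable function on $\mathcal H$. Intervals $I\subset\mathbb R$ are bounded and of positive length $|I|$. For an interval $I$, $Q_I=\{x+iy: x\in I,\ 0<y<|I|\}$, $|Q_I|=\int_{Q_I}dV$, and $\omega(Q_I)=|Q_I|_\omega=\int_{Q_I}\omega\,dV$. For $1\le r<\infty$, $L^r_\omega(\mathcal H)$ is the set of functions $f$ on $\mathcal H$ with $\|f\|_{r,\omega}^r=\int_{\mathcal H}|f(z)|^r\omega(z)\,dV(z)<\infty$. For $1<p<\infty$, with $pp'=p+p'$, the weight $\omega$ is in the Békollé-Bonami class $B_p$ if $$[\omega]_{B_p}=\sup_{I\subset\mathbb R\ \text{interval}}\left(\frac1{|Q_I|}\int_{Q_I}\omega\,dV\right)\left(\frac1{|Q_I|}\int_{Q_I}\omega^{1-p'}\,dV\right)^{p-1}<\infty.$$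 The weighted Hardy-Littlewood maximal function is $$M_\omega f(z)=\sup_{I\subset\mathbb R\ \text{interval},\ z\in Q_I}\frac1{\omega(Q_I)}\int_{Q_I}|f|\,\omega\,dV .$$ *)

theory Defs
  imports "HOL-Analysis.Analysis"
begin

definition uhp :: "complex set" where
  "uhp = {z. 0 < Im z}"

text \<open>
  Real powers of extended nonnegative reals. In particular \<open>0\<close> to a negative power is
  \<open>\<infinity>\<close>, so that \<open>\<omega>\<^bsup>1-p'\<^esup>\<close> takes the value \<open>\<infinity>\<close> on the zero set of
  \<open>\<omega>\<close> (with the real-valued \<^const>\<open>powr\<close> it would be \<open>0\<close> there).
\<close>

definition epowr :: "ennreal \<Rightarrow> real \<Rightarrow> ennreal" where
  "epowr x a =
     (if a = 0 then 1
      else if x = 0 then (if a < 0 then \<infinity> else 0)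
      else if x = \<infinity> then (if a < 0 then 0 else \<infinity>)
      else ennreal (enn2real x powr a))"

text \<open>Intervals may be open, closed or half-open; for bounded intervals the Lebesgue measure
  is the length.\<close>

definition intervals :: "real set set" where
  "intervals = {I. is_interval I \<and> bounded I \<and> 0 < measure lborel I}"

definition Q_box :: "real set \<Rightarrow> complex set" where
  "Q_box I = {z. Re z \<in> I \<and> 0 < Im z \<and> Im z < measure lborel I}"

text \<open>
  Functions on the upper half-plane are modelled by functions on \<^typ>\<open>complex\<close>; all notions
  below only depend on their values on \<^const>\<open>uhp\<close>. Local integrability refers to the compact
  subsets of \<^const>\<open>uhp\<close>.
\<close>

definition weight :: "(complex \<Rightarrow> real) \<Rightarrow> bool" where
  "weight \<omega> \<longleftrightarrow>
     (\<forall>z\<in>uhp. 0 \<le> \<omega> z) \<and>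
     (\<forall>K. compact K \<and> K \<subseteq> uhp \<longrightarrow> \<omega> absolutely_integrable_on K)"

definition wmeasure :: "(complex \<Rightarrow> real) \<Rightarrow> complex set \<Rightarrow> ennreal" where
  "wmeasure \<omega> A = (\<integral>\<^sup>+z\<in>A. ennreal (\<omega> z) \<partial>lebesgue)"

text \<open>The weighted norm is defined for \<open>[0,\<infinity>]\<close>-valued functions, as it is applied both to
  \<open>|f|\<close> and to suprema that may be infinite.\<close>

definition wnorm :: "real \<Rightarrow> (complex \<Rightarrow> real) \<Rightarrow> (complex \<Rightarrow> ennreal) \<Rightarrow> ennreal" where
  "wnorm r \<omega> F =
     epowr (\<integral>\<^sup>+z\<in>uhp. epowr (F z) r * ennreal (\<omega> z) \<partial>lebesgue) (1 / r)"

definition L_space :: "real \<Rightarrow> (complex \<Rightarrow> real) \<Rightarrow> (complex \<Rightarrow> complex) set" where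
  "L_space r \<omega> =
     {f. f \<in> borel_measurable (lebesgue_on uhp) \<and> wnorm r \<omega> (\<lambda>z. ennreal (cmod (f z))) < \<infinity>}"

definition L_space_ext :: "real \<Rightarrow> (complex \<Rightarrow> real) \<Rightarrow> (complex \<Rightarrow> ennreal) set" where
  "L_space_ext r \<omega> =
     {F. F \<in> borel_measurable (lebesgue_on uhp) \<and> wnorm r \<omega> F < \<infinity>}"

definition conj_exp :: "real \<Rightarrow> real" where
  "conj_exp p = p / (p - 1)"

lemma conj_exp_iff: "1 < p \<Longrightarrow> p * p' = p + p' \<longleftrightarrow> p' = conj_exp p"
  by (auto simp: conj_exp_def field_simps)

definition Bp_const :: "real \<Rightarrow> (complex \<Rightarrow> real) \<Rightarrow> ennreal" where
  "Bp_const p \<omega> =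
     (SUP I\<in>intervals.
        (\<integral>\<^sup>+z\<in>Q_box I. ennreal (\<omega> z) \<partial>lebesgue) / emeasure lebesgue (Q_box I) *
        epowr ((\<integral>\<^sup>+z\<in>Q_box I. epowr (ennreal (\<omega> z)) (1 - conj_exp p) \<partial>lebesgue)
                 / emeasure lebesgue (Q_box I)) (p - 1))"

definition Bp_class :: "real \<Rightarrow> (complex \<Rightarrow> real) set" where
  "Bp_class p = {\<omega>. weight \<omega> \<and> Bp_const p \<omega> < \<infinity>}"

definition maximal_fun ::
    "(complex \<Rightarrow> real) \<Rightarrow> (complex \<Rightarrow> complex) \<Rightarrow> complex \<Rightarrow> ennreal" where
  "maximal_fun \<omega> f z =
     (SUP I\<in>{I\<in>intervals. z \<in> Q_box I}.
        (\<integral>\<^sup>+w\<in>Q_box I. ennreal (cmod (f w)) * ennreal (\<omega> w) \<partial>lebesgue) / wmeasure \<omega> (Q_box I))"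

definition K_fun :: "complex measure \<Rightarrow> (complex \<Rightarrow> real) \<Rightarrow> complex \<Rightarrow> ennreal" where
  "K_fun \<mu> \<omega> z =
     (SUP I\<in>{I\<in>intervals. z \<in> Q_box I}. emeasure \<mu> (Q_box I) / wmeasure \<omega> (Q_box I))"

end

theory Submission
  imports Defs
begin

text \<open>
  Write \<open>\<nu>\<close> for the measure \<open>\<omega> dV\<close> on the upper half-plane. The main use of the
  condition \<open>B\<^sub>p\<close> is the doubling property \<open>\<nu>(Q\<^sub>3\<^sub>I) \<le> D \<nu>(Q\<^sub>I)\<close>, which follows from Hoelder's
  inequality for \<open>1 = \<omega>\<^bsup>1/p\<^esup> \<omega>\<^bsup>-1/p\<^esup>\<close> on \<open>Q\<^sub>I\<close> (\<open>volume_le\<close>, \<open>doubling_weight_measure\<close>).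
  A weight in \<open>B\<^sub>p\<close> that vanishes almost everywhere on one box vanishes almost everywhere, and
  then both sides of the equivalence are true; otherwise every box has positive finite \<open>\<nu>\<close>-measure.

  Two boxes over intersecting intervals are comparable by inclusion after tripling the longer
  interval, so a finite family of boxes contains disjoint ones whose triples cover the union
  (\<open>vitali_qbox\<close>). Let \<open>S\<close> be the supremum of \<open>\<mu>(Q) / \<nu>(Q)\<close> over the boxes \<open>Q\<close> of a finite family
  that contain a point. Together with doubling, the covering gives two dual estimates. A level
  set of \<open>S\<close> satisfies \<open>t \<nu>{S > t} \<le> D \<mu>{S > t}\<close> (\<open>weak_type\<close>), and every finite union \<open>O\<close> of
  boxes satisfies \<open>\<mu>(O) \<le> D \<integral>\<^sub>O K d\<nu>\<close> as soon as \<open>K\<close> dominates all the ratios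
  (\<open>emeasure_UN_qbox_le\<close>). Integrated over the levels \<open>t\<close>, they become
  \<open>\<integral> S\<^bsup>a+1\<^esup> d\<nu> \<le> D (a+1)/a \<integral> S\<^bsup>a\<^esup> d\<mu>\<close> and \<open>\<integral> G\<^bsup>q\<^esup> d\<mu> \<le> D \<integral> G\<^bsup>q\<^esup> K d\<nu>\<close>, the latter for
  every \<open>G\<close> whose superlevel sets are unions of boxes.

  The first estimate, for \<open>d\<mu> = f d\<nu>\<close> and \<open>a = p - 1\<close>, is Doob's proof that the maximal operator
  is bounded on \<open>L\<^sup>p(\<nu>)\<close>. If \<open>K\<^sub>\<mu>\<close> lies in \<open>L\<^sup>s(\<nu>)\<close>, the second estimate for \<open>G = M\<^sub>\<omega> f\<close>,
  Hoelder's inequality with exponents \<open>p/q\<close> and \<open>s\<close>, and the maximal theorem yield the bound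
  for \<open>M\<^sub>\<omega>\<close>. Conversely, test this bound on \<open>g = S\<^bsup>1/(p-q)\<^esup>\<close>. Since \<open>S\<close> is at least
  \<open>\<mu>(Q) / \<nu>(Q)\<close> on each \<open>Q\<close> of the family, \<open>M\<^sub>\<omega> g \<ge> g\<close> pointwise; the first estimate for
  \<open>a = q/(p-q)\<close>, where \<open>a + 1 = s\<close>, then bounds \<open>\<integral> S\<^sup>s d\<nu>\<close> by a multiple of its own power with
  exponent \<open>q/p < 1\<close>. Hence it is bounded independently of the family, and \<open>S\<close> increases to
  \<open>K\<^sub>\<mu>\<close>.

  Both suprema range over uncountably many intervals of all types. Enlarging an interval slightly
  changes \<open>\<nu>(Q\<^sub>I)\<close> slightly and does not decrease the numerators, so that open intervals with
  rational endpoints suffice (\<open>SUP_intervals_eq_maxop\<close>). This makes the suprema measurable and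
  limits of suprema over finite families.
\<close>

section \<open>Powers of extended nonnegative reals and integral inequalities\<close>

lemma epowr_zero [simp]: "0 < a \<Longrightarrow> epowr 0 a = 0"
  by (simp add: epowr_def)

lemma epowr_top [simp]: "0 < a \<Longrightarrow> epowr top a = top"
  by (simp add: epowr_def)

lemma epowr_ennreal: "0 < a \<Longrightarrow> 0 \<le> r \<Longrightarrow> epowr (ennreal r) a = ennreal (r powr a)"
  by (simp add: epowr_def ennreal_eq_0_iff)

lemma epowr_one [simp]: "epowr x 1 = x"
  by (cases x) (auto simp: epowr_def powr_one)

lemma epowr_mono:
  assumes "0 < a" "x \<le> y"
  shows "epowr x a \<le> epowr y a"
  using assms by (cases x; cases y) (auto simp: epowr_ennreal top_unique intro!: powr_mono2)

lemma epowr_epowr: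
  assumes "0 < a" "0 < b"
  shows "epowr (epowr x a) b = epowr x (a * b)"
  using assms by (cases x) (auto simp: epowr_ennreal powr_powr)

lemma epowr_mult:
  assumes "0 < a"
  shows "epowr (x * y) a = epowr x a * epowr y a"
  using assms
  by (cases x; cases y)
     (auto simp: epowr_ennreal powr_mult ennreal_mult[symmetric] ennreal_top_mult ennreal_mult_top)

lemma epowr_eq_0_iff [simp]: "0 < a \<Longrightarrow> epowr x a = 0 \<longleftrightarrow> x = 0"
  by (cases x) (auto simp: epowr_ennreal ennreal_eq_0_iff)

lemma epowr_eq_top_iff [simp]: "0 < a \<Longrightarrow> epowr x a = top \<longleftrightarrow> x = top"
  by (cases x) (auto simp: epowr_ennreal)

lemma epowr_less_top_iff [simp]: "0 < a \<Longrightarrow> epowr x a < top \<longleftrightarrow> x < top"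
  by (simp add: less_top[symmetric])

lemma epowr_le_iff:
  assumes "0 < a"
  shows "epowr x a \<le> y \<longleftrightarrow> x \<le> epowr y (1 / a)"
proof
  assume "epowr x a \<le> y"
  from epowr_mono[OF _ this, of "1 / a"] assms show "x \<le> epowr y (1 / a)"
    by (simp add: epowr_epowr)
next
  assume "x \<le> epowr y (1 / a)"
  from epowr_mono[OF assms this] assms show "epowr x a \<le> y"
    by (simp add: epowr_epowr)
qed

text \<open>Taking a positive power is an order isomorphism of \<open>[0,\<infinity>]\<close>, hence preserves suprema.\<close>

lemma epowr_SUP:
  assumes "0 < a"
  shows "epowr (SUP i\<in>I. f i) a = (SUP i\<in>I. epowr (f i) a)"
proof (rule antisym)
  show "epowr (SUP i\<in>I. f i) a \<le> (SUP i\<in>I. epowr (f i) a)"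
    unfolding epowr_le_iff[OF assms]
    by (intro SUP_least) (auto simp: epowr_le_iff[OF assms, symmetric] intro: SUP_upper)
  show "(SUP i\<in>I. epowr (f i) a) \<le> epowr (SUP i\<in>I. f i) a"
    by (intro SUP_least epowr_mono assms SUP_upper)
qed

lemma borel_measurable_epowr [measurable]:
  "(\<lambda>x. epowr x a) \<in> borel_measurable borel"
  unfolding epowr_def by measurable

lemma epowr_Youngs_inequality:
  assumes "1 < p" "1 < q" "1 / p + 1 / q = 1"
  shows "x * y \<le> epowr x p / ennreal p + epowr y q / ennreal q"
proof (cases "x = top \<or> y = top")
  case True
  with assms show ?thesis
    by (auto simp: ennreal_top_divide)
next
  case False
  then obtain a b where [simp]: "x = ennreal a" "y = ennreal b" "0 \<le> a" "0 \<le> b"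
    by (cases x; cases y) auto
  have "a * b \<le> a powr p / p + b powr q / q"
    using Youngs_inequality[of p q a b] assms by simp
  then show ?thesis
    using assms
    by (simp add: epowr_ennreal divide_ennreal ennreal_mult[symmetric] ennreal_plus[symmetric]
        del: ennreal_plus)
qed

text \<open>
  The usual proof: after normalising both factors, integrate Young's inequality. The degenerate
  values \<open>0\<close> and \<open>\<infinity>\<close> of the norms do no harm because \<open>0 \<cdot> \<infinity> = 0\<close>: a factor of norm \<open>0\<close>
  vanishes almost everywhere.
\<close>

lemma nn_integral_Hoelder:
  assumes pq: "1 < p" "1 < q" "1 / p + 1 / q = 1"
    and f: "f \<in> borel_measurable M" and g: "g \<in> borel_measurable M"
  shows "(\<integral>\<^sup>+x. f x * g x \<partial>M)
         \<le> epowr (\<integral>\<^sup>+x. epowr (f x) p \<partial>M) (1 / p) * epowr (\<integral>\<^sup>+x. epowr (g x) q \<partial>M) (1 / q)"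
proof -
  note [measurable] = f g
  define A B where "A = (\<integral>\<^sup>+x. epowr (f x) p \<partial>M)" and "B = (\<integral>\<^sup>+x. epowr (g x) q \<partial>M)"
  define \<alpha> \<beta> where "\<alpha> = epowr A (1 / p)" and "\<beta> = epowr B (1 / q)"
  consider "A = 0" | "B = 0" | "A \<noteq> 0" "B \<noteq> 0" "A = top \<or> B = top"
    | "A \<noteq> 0" "B \<noteq> 0" "A < top" "B < top"
    using less_top[of A] less_top[of B] by blast
  then have "(\<integral>\<^sup>+x. f x * g x \<partial>M) \<le> \<alpha> * \<beta>"
  proof cases
    case 1
    then have "AE x in M. f x = 0"
      using pq by (auto simp: A_def nn_integral_0_iff_AE)
    then have "(\<integral>\<^sup>+x. f x * g x \<partial>M) = (\<integral>\<^sup>+x. 0 \<partial>M)"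
      by (intro nn_integral_cong_AE) auto
    then show ?thesis by simp
  next
    case 2
    then have "AE x in M. g x = 0"
      using pq by (auto simp: B_def nn_integral_0_iff_AE)
    then have "(\<integral>\<^sup>+x. f x * g x \<partial>M) = (\<integral>\<^sup>+x. 0 \<partial>M)"
      by (intro nn_integral_cong_AE) auto
    then show ?thesis by simp
  next
    case 3
    then have "\<alpha> * \<beta> = top"
      using pq by (auto simp: \<alpha>_def \<beta>_def ennreal_top_mult ennreal_mult_top)
    then show ?thesis by simp
  next
    case 4
    have ab: "\<alpha> \<noteq> 0" "\<beta> \<noteq> 0" "\<alpha> < top" "\<beta> < top"
      using 4 pq by (auto simp: \<alpha>_def \<beta>_def)
    have powA: "epowr \<alpha> p = A" "epowr \<beta> q = B"
      using pq by (simp_all add: \<alpha>_def \<beta>_def epowr_epowr)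
    have inv: "epowr (inverse \<alpha>) p * A = 1" "epowr (inverse \<beta>) q * B = 1"
      unfolding powA[symmetric]
      using ab pq
      by (auto simp: epowr_mult[symmetric] ennreal_divide_self[unfolded divide_ennreal_def] mult.commute
          epowr_ennreal[of _ 1, simplified])
    have "(\<integral>\<^sup>+x. (inverse \<alpha> * f x) * (inverse \<beta> * g x) \<partial>M)
        \<le> (\<integral>\<^sup>+x. epowr (inverse \<alpha> * f x) p / ennreal p + epowr (inverse \<beta> * g x) q / ennreal q \<partial>M)"
      by (intro nn_integral_mono epowr_Youngs_inequality pq)
    also have "\<dots> = (epowr (inverse \<alpha>) p * A) / ennreal p + (epowr (inverse \<beta>) q * B) / ennreal q"
      using pq by (simp add: nn_integral_add nn_integral_divide epowr_mult nn_integral_cmult A_def B_def)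
    also have "\<dots> = ennreal (1 / p + 1 / q)"
      using pq by (simp add: inv divide_ennreal[of 1, simplified] ennreal_plus[symmetric] del: ennreal_plus)
    finally have le: "(\<integral>\<^sup>+x. (inverse \<alpha> * f x) * (inverse \<beta> * g x) \<partial>M) \<le> 1"
      by (simp add: pq)
    have "(\<alpha> * \<beta>) * ((inverse \<alpha> * f x) * (inverse \<beta> * g x)) = f x * g x" for x
    proof -
      have "(\<alpha> * \<beta>) * ((inverse \<alpha> * f x) * (inverse \<beta> * g x))
          = (\<alpha> * inverse \<alpha>) * (\<beta> * inverse \<beta>) * (f x * g x)"
        by (simp add: ac_simps)
      then show ?thesis
        using ab by (simp add: ennreal_divide_self[unfolded divide_ennreal_def])
    qed
    then have "(\<integral>\<^sup>+x. f x * g x \<partial>M)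
        = (\<alpha> * \<beta>) * (\<integral>\<^sup>+x. (inverse \<alpha> * f x) * (inverse \<beta> * g x) \<partial>M)"
      by (subst nn_integral_cmult[symmetric]) auto
    also have "\<dots> \<le> (\<alpha> * \<beta>) * 1"
      by (intro mult_left_mono le) auto
    finally show ?thesis by simp
  qed
  then show ?thesis by (simp add: A_def B_def \<alpha>_def \<beta>_def)
qed

text \<open>
  This turns a self-improving estimate into an a priori bound: the power of \<open>X\<close> on the right-hand
  side is divided out, which is legitimate because \<open>X\<close> is finite.
\<close>

lemma le_epowr_absorb:
  assumes le: "X \<le> B * epowr X (1 - \<theta>)" and fin: "X < top" and \<theta>: "0 < \<theta>" "\<theta> < 1"
  shows "X \<le> epowr B (1 / \<theta>)"
proof (cases "X = 0 \<or> B = top")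
  case True
  with \<theta> show ?thesis by auto
next
  case False
  then obtain x b where [simp]: "X = ennreal x" "B = ennreal b" and x: "0 < x" and b: "0 \<le> b"
    using fin by (cases X; cases B) (auto simp: order_le_less)
  have "x \<le> b * x powr (1 - \<theta>)"
    using le x b \<theta> by (simp add: epowr_ennreal ennreal_mult[symmetric])
  then have "x powr \<theta> \<le> b"
    using x by (simp add: powr_diff field_simps)
  then have "(x powr \<theta>) powr (1 / \<theta>) \<le> b powr (1 / \<theta>)"
    using \<theta> by (intro powr_mono2) auto
  then show ?thesis
    using x b \<theta> by (simp add: epowr_ennreal powr_powr)
qed

text \<open>
  The fundamental theorem of calculus for \<open>t\<^sup>a\<close>; for \<open>a < 1\<close> the derivative is singular but
  integrable at \<open>0\<close>.
\<close>

lemma epowr_eq_nn_integral: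
  assumes "0 < a" "h < top"
  shows "epowr h a = (\<integral>\<^sup>+t. ennreal (a * t powr (a - 1)) * indicator {t. 0 \<le> t \<and> ennreal t < h} t \<partial>lborel)"
proof -
  obtain c where c: "h = ennreal c" "0 \<le> c"
    using assms by (cases h) auto
  have "((\<lambda>t. a * t powr (a - 1)) has_integral (a * (c powr (a - 1 + 1) / (a - 1 + 1)))) {0..c}"
    using assms c by (intro has_integral_mult_right has_integral_powr_from_0) auto
  then have "((\<lambda>t. a * t powr (a - 1)) has_integral (c powr a)) {0..c}"
    using assms by simp
  then have "(\<integral>\<^sup>+t. ennreal (a * t powr (a - 1)) * indicator {0..c} t \<partial>lborel) = ennreal (c powr a)"
    using assms
    by (intro nn_integral_has_integral_lebesgue') auto
  moreover have "(\<integral>\<^sup>+t. ennreal (a * t powr (a - 1)) * indicator {t. 0 \<le> t \<and> ennreal t < h} t \<partial>lborel)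
      = (\<integral>\<^sup>+t. ennreal (a * t powr (a - 1)) * indicator {0..c} t \<partial>lborel)"
  proof (rule nn_integral_cong_AE)
    show "AE t in lborel. ennreal (a * t powr (a - 1)) * indicator {t. 0 \<le> t \<and> ennreal t < h} t
        = ennreal (a * t powr (a - 1)) * indicator {0..c} t"
      using AE_lborel_singleton[of c]
      by eventually_elim (auto simp: c ennreal_less_iff indicator_def)
  qed
  ultimately show ?thesis
    using assms c by (simp add: epowr_ennreal)
qed

text \<open>
  Layer cake formula for the measure \<open>g dM\<close>, by Tonelli's theorem for \<open>M\<close> and Lebesgue measure on
  the levels \<open>t\<close>. The density is kept apart from \<open>M\<close> because \<open>g\<close> may be infinite on a set of
  positive measure, and then \<open>g dM\<close> fails to be sigma-finite.
\<close>

lemma nn_integral_layer_cake: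
  assumes M: "sigma_finite_measure M" and a: "0 < a"
    and h: "h \<in> borel_measurable M" and g: "g \<in> borel_measurable M"
    and fin: "\<And>x. x \<in> space M \<Longrightarrow> h x < top"
  shows "(\<integral>\<^sup>+x. epowr (h x) a * g x \<partial>M)
    = (\<integral>\<^sup>+t. ennreal (a * t powr (a - 1)) * indicator {0..} t
             * (\<integral>\<^sup>+x. g x * indicator {x. ennreal t < h x} x \<partial>M) \<partial>lborel)"
proof -
  interpret M: sigma_finite_measure M by fact
  interpret P: pair_sigma_finite M lborel ..
  note [measurable] = h g
  have "(\<integral>\<^sup>+x. epowr (h x) a * g x \<partial>M)
     = (\<integral>\<^sup>+x. \<integral>\<^sup>+t. ennreal (a * t powr (a - 1)) * indicator {0..} t * (g x * indicator {x. ennreal t < h x} x) \<partial>lborel \<partial>M)"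
  proof (rule nn_integral_cong)
    fix x assume x: "x \<in> space M"
    have "epowr (h x) a * g x
        = (\<integral>\<^sup>+t. ennreal (a * t powr (a - 1)) * indicator {t. 0 \<le> t \<and> ennreal t < h x} t * g x \<partial>lborel)"
      unfolding epowr_eq_nn_integral[OF a fin[OF x]]
      by (rule nn_integral_multc[symmetric]) measurable
    also have "\<dots> = (\<integral>\<^sup>+t. ennreal (a * t powr (a - 1)) * indicator {0..} t * (g x * indicator {x. ennreal t < h x} x) \<partial>lborel)"
      by (intro nn_integral_cong) (auto simp: indicator_def)
    finally show "epowr (h x) a * g x = \<dots>" .
  qed
  also have "\<dots> = (\<integral>\<^sup>+t. \<integral>\<^sup>+x. ennreal (a * t powr (a - 1)) * indicator {0..} t * (g x * indicator {x. ennreal t < h x} x) \<partial>M \<partial>lborel)"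
    by (rule P.Fubini'[symmetric]) measurable
  also have "\<dots> = (\<integral>\<^sup>+t. ennreal (a * t powr (a - 1)) * indicator {0..} t
             * (\<integral>\<^sup>+x. g x * indicator {x. ennreal t < h x} x \<partial>M) \<partial>lborel)"
    by (intro nn_integral_cong nn_integral_cmult) measurable
  finally show ?thesis .
qed

section \<open>Open boxes over intervals and suprema over boxes\<close>

text \<open>
  The box over the open interval with endpoints \<open>fst I\<close> and \<open>snd I\<close>. Coding intervals by pairs gives
  the degenerate pairs an empty box, so that most facts about boxes hold for all pairs.
\<close>

definition qbox :: "real \<times> real \<Rightarrow> complex set" where
  "qbox I = {z. fst I < Re z \<and> Re z < snd I \<and> 0 < Im z \<and> Im z < snd I - fst I}"

definition triple :: "real \<times> real \<Rightarrow> real \<times> real" where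
  "triple I = (2 * fst I - snd I, 2 * snd I - fst I)"

text \<open>
  The common shape of the maximal function and of \<open>K\<^sub>\<mu>\<close>: \<open>c\<close> holds the ratios that belong to the
  boxes, and \<open>F\<close> is the family of intervals that are admitted.
\<close>

definition maxop :: "(real \<times> real) set \<Rightarrow> (real \<times> real \<Rightarrow> ennreal) \<Rightarrow> complex \<Rightarrow> ennreal" where
  "maxop F c z = (SUP I\<in>F. c I * indicator (qbox I) z)"

lemma qbox_subset_uhp: "qbox I \<subseteq> uhp"
  by (auto simp: qbox_def uhp_def)

lemma qbox_mono: "fst J \<le> fst I \<Longrightarrow> snd I \<le> snd J \<Longrightarrow> qbox I \<subseteq> qbox J"
  by (auto simp: qbox_def)

text \<open>
  Both extents of a box are governed by the same interval: if \<open>I\<close> is no longer than \<open>J\<close> and meets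
  it, then \<open>I\<close> lies in the tripled interval, and the box over \<open>I\<close> is also the lower one.
\<close>

lemma qbox_subset_triple:
  assumes "qbox I \<inter> qbox J \<noteq> {}" "snd I - fst I \<le> snd J - fst J"
  shows "qbox I \<subseteq> qbox (triple J)"
  using assms by (intro qbox_mono) (auto simp: qbox_def triple_def)

text \<open>
  The finite Vitali covering lemma by greedy selection: take a box over a longest interval, discard
  all boxes that meet it, which its triple covers, and continue with the rest.
\<close>

lemma vitali_qbox:
  assumes "finite F"
  shows "\<exists>G\<subseteq>F. disjoint_family_on qbox G \<and> (\<forall>I\<in>F. \<exists>J\<in>G. qbox I \<subseteq> qbox (triple J))"
  using assms
proof (induction F rule: finite_psubset_induct)
  case (psubset F)
  show ?case
  proof (cases "\<exists>I\<in>F. qbox I \<noteq> {}")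
    case False
    show ?thesis
    proof (cases "F = {}")
      case False
      then obtain I where "I \<in> F" by blast
      with \<open>\<not> (\<exists>I\<in>F. qbox I \<noteq> {})\<close> show ?thesis
        by (intro exI[of _ "{I}"]) (auto simp: disjoint_family_on_def)
    qed (auto simp: disjoint_family_on_def)
  next
    case True
    define E where "E = {I\<in>F. qbox I \<noteq> {}}"
    have E: "finite E" "E \<noteq> {}"
      using psubset.hyps True by (auto simp: E_def)
    \<comment> \<open>A longest interval is chosen first, so that the triple of its box covers every box meeting it.\<close>
    have "Max ((\<lambda>I. snd I - fst I) ` E) \<in> (\<lambda>I. snd I - fst I) ` E"
      using E by (intro Max_in) auto
    then obtain J where J: "J \<in> E" "Max ((\<lambda>I. snd I - fst I) ` E) = snd J - fst J"
      by (elim imageE)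
    have J_max: "snd I - fst I \<le> snd J - fst J" if "I \<in> E" for I
      unfolding J(2)[symmetric] by (intro Max_ge finite_imageI E imageI that)
    define F' where "F' = {I\<in>F. qbox I \<inter> qbox J = {}}"
    have "F' \<subset> F"
      using J by (auto simp: F'_def E_def)
    from psubset.IH[OF this] obtain G where G: "G \<subseteq> F'" "disjoint_family_on qbox G"
      "\<forall>I\<in>F'. \<exists>J\<in>G. qbox I \<subseteq> qbox (triple J)" by blast
    have "disjoint_family_on qbox (insert J G)"
      using G(1,2) by (auto simp: disjoint_family_on_def F'_def)
    moreover have "\<exists>L\<in>insert J G. qbox I \<subseteq> qbox (triple L)" if I: "I \<in> F" for I
    proof (cases "I \<in> F'")
      case True
      then show ?thesis using G(3) by blast
    next
      case False
      with I have "I \<in> E" "qbox I \<inter> qbox J \<noteq> {}" by (auto simp: F'_def E_def)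
      then show ?thesis using qbox_subset_triple J(1) J_max by blast
    qed
    moreover have "insert J G \<subseteq> F"
      using G(1) J(1) by (auto simp: F'_def E_def)
    ultimately show ?thesis by blast
  qed
qed

lemma less_maxop_iff: "t < maxop F c z \<longleftrightarrow> (\<exists>I\<in>F. t < c I \<and> z \<in> qbox I)"
  by (auto simp: maxop_def less_SUP_iff indicator_def)

text \<open>
  Because superlevel sets are unions of boxes, covering arguments apply to them.
\<close>

lemma level_set_maxop: "{z. t < maxop F c z} = (\<Union>I\<in>{I\<in>F. t < c I}. qbox I)"
  by (auto simp: less_maxop_iff)

lemma maxop_upper: "I \<in> F \<Longrightarrow> z \<in> qbox I \<Longrightarrow> c I \<le> maxop F c z"
  unfolding maxop_def by (intro SUP_upper2[of I]) auto

lemma maxop_least: "(\<And>I. I \<in> F \<Longrightarrow> z \<in> qbox I \<Longrightarrow> c I \<le> y) \<Longrightarrow> maxop F c z \<le> y"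
  unfolding maxop_def by (intro SUP_least) (auto simp: indicator_def)

lemma maxop_mono: "F \<subseteq> G \<Longrightarrow> maxop F c z \<le> maxop G c z"
  by (auto intro!: maxop_least maxop_upper)

lemma epowr_maxop:
  assumes "0 < a"
  shows "epowr (maxop F c z) a = maxop F (\<lambda>I. epowr (c I) a) z"
  unfolding maxop_def epowr_SUP[OF assms]
  using assms by (intro SUP_cong) (auto simp: indicator_def)

lemma maxop_le_sum: "finite F \<Longrightarrow> maxop F c z \<le> (\<Sum>I\<in>F. c I * indicator (qbox I) z)"
  unfolding maxop_def by (intro SUP_least member_le_sum) auto

lemma maxop_less_top:
  assumes "finite F" "\<And>I. I \<in> F \<Longrightarrow> c I < top"
  shows "maxop F c z < top"
proof -
  have "(\<Sum>I\<in>F. c I * indicator (qbox I) z) < top"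
    using assms by (auto simp: ennreal_mult_less_top indicator_def)
  with maxop_le_sum[OF assms(1), of c z] show ?thesis by (rule le_less_trans)
qed

lemma borel_measurable_maxop:
  assumes "countable F" "\<And>I. I \<in> F \<Longrightarrow> qbox I \<in> sets M"
  shows "maxop F c \<in> borel_measurable M"
  unfolding maxop_def
  using assms by (intro borel_measurable_SUP) auto

lemma maxop_countable_SUP:
  assumes "countable R"
  obtains F where "\<And>n::nat. finite (F n)" "\<And>n. F n \<subseteq> R" "incseq F"
    "\<And>c z. maxop R c z = (SUP n. maxop (F n) c z)"
proof (cases "R = {}")
  case True
  then show ?thesis
    by (intro that[of "\<lambda>_. {}"]) (auto simp: incseq_def maxop_def)
next
  case False
  define F where "F n = from_nat_into R ` {..n}" for n
  have "R = (\<Union>n. F n)"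
  proof (intro antisym subsetI)
    fix I assume "I \<in> R"
    then obtain n where "from_nat_into R n = I"
      using from_nat_into_surj[OF assms] by blast
    then show "I \<in> (\<Union>n. F n)" by (auto simp: F_def)
  qed (auto simp: F_def from_nat_into[OF False])
  show ?thesis
  proof (rule that[of F])
    show "maxop R c z = (SUP n. maxop (F n) c z)" for c z
      unfolding maxop_def by (subst \<open>R = (\<Union>n. F n)\<close>) (rule SUP_UNION)
  qed (use from_nat_into[OF False] in \<open>auto simp: F_def incseq_def\<close>)
qed

text \<open>
  Monotone convergence reduces bounds for the supremum over a countable family to bounds that are
  uniform in finite subfamilies. For the latter, integrals are finite and covering lemmas apply.
\<close>

lemma nn_integral_maxop_le:
  assumes R: "countable R" "\<And>I. I \<in> R \<Longrightarrow> qbox I \<in> sets M" and a: "0 < a"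
    and le: "\<And>F. finite F \<Longrightarrow> F \<subseteq> R \<Longrightarrow> (\<integral>\<^sup>+z. epowr (maxop F c z) a \<partial>M) \<le> B"
  shows "(\<integral>\<^sup>+z. epowr (maxop R c z) a \<partial>M) \<le> B"
proof -
  obtain F where F: "\<And>n::nat. finite (F n)" "\<And>n. F n \<subseteq> R" "incseq F"
    "\<And>c z. maxop R c z = (SUP n. maxop (F n) c z)"
    using maxop_countable_SUP[OF R(1)] by blast
  have [measurable]: "maxop (F n) c \<in> borel_measurable M" for n
    using F(2) by (intro borel_measurable_maxop countable_finite F(1) R(2)) blast
  have "(\<integral>\<^sup>+z. epowr (maxop R c z) a \<partial>M) = (\<integral>\<^sup>+z. (SUP n. epowr (maxop (F n) c z) a) \<partial>M)"
    using a by (simp add: F(4) epowr_SUP)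
  also have "\<dots> = (SUP n. \<integral>\<^sup>+z. epowr (maxop (F n) c z) a \<partial>M)"
    using a F(3)
    by (intro nn_integral_monotone_convergence_SUP)
       (auto simp: incseq_def le_fun_def intro!: epowr_mono maxop_mono)
  also have "\<dots> \<le> B"
    by (intro SUP_least le F)
  finally show ?thesis .
qed

lemma uhp_eq_UN_qbox: "uhp = (\<Union>n. qbox (- real n, real n))"
proof (intro antisym subsetI)
  fix z assume z: "z \<in> uhp"
  obtain n where "\<bar>Re z\<bar> + Im z < real n" using reals_Archimedean2 by blast
  with z have "z \<in> qbox (- real n, real n)" by (auto simp: qbox_def uhp_def)
  then show "z \<in> (\<Union>n. qbox (- real n, real n))" by blast
qed (use qbox_subset_uhp in blast)

lemma sigma_finite_measure_qbox:
  assumes "space M = uhp" "\<And>I. qbox I \<in> sets M" "\<And>I. emeasure M (qbox I) < top"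
  shows "sigma_finite_measure M"
proof
  show "\<exists>A. countable A \<and> A \<subseteq> sets M \<and> \<Union> A = space M \<and> (\<forall>a\<in>A. emeasure M a \<noteq> \<infinity>)"
    using assms uhp_eq_UN_qbox
    by (intro exI[of _ "range (\<lambda>n. qbox (- real n, real n))"]) (auto simp: less_top)
qed

lemma nn_integral_eq_0_if_qbox_null:
  assumes "space M = uhp" "\<And>I. qbox I \<in> sets M" "\<And>I. emeasure M (qbox I) = 0"
  shows "(\<integral>\<^sup>+z. F z \<partial>M) = 0"
proof -
  have "uhp \<in> null_sets M"
    unfolding uhp_eq_UN_qbox by (intro null_sets_UN null_setsI assms)
  then have "(\<integral>\<^sup>+z. F z \<partial>M) = (\<integral>\<^sup>+z. 0 \<partial>M)"
    by (intro nn_integral_cong_AE AE_I'[of uhp]) (auto simp: assms(1))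
  then show ?thesis by simp
qed

definition rat_intervals :: "(real \<times> real) set" where
  "rat_intervals = {I. fst I < snd I \<and> fst I \<in> \<rat> \<and> snd I \<in> \<rat>}"

lemma countable_rat_intervals: "countable rat_intervals"
  by (rule countable_subset[of _ "\<rat> \<times> \<rat>"])
     (auto simp: rat_intervals_def mem_Times_iff intro: countable_rat)

section \<open>Covering estimates for measures that double on boxes\<close>

text \<open>
  The properties of \<open>\<omega> dV\<close> that the covering arguments rest on.
\<close>

locale qbox_doubling =
  fixes \<nu> :: "complex measure" and D :: ennreal
  assumes space_nu: "space \<nu> = uhp"
    and qbox_sets: "qbox I \<in> sets \<nu>"
    and qbox_pos: "fst I < snd I \<Longrightarrow> 0 < emeasure \<nu> (qbox I)"
    and qbox_finite: "emeasure \<nu> (qbox I) < top"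
    and doubling: "emeasure \<nu> (qbox (triple I)) \<le> D * emeasure \<nu> (qbox I)"
    and D_finite: "D < top"
begin

lemma sigma_finite_nu: "sigma_finite_measure \<nu>"
  by (intro sigma_finite_measure_qbox space_nu qbox_sets qbox_finite)

text \<open>
  The symbol of the embedding: \<open>K\<^sub>\<mu>\<close> is the supremum of these ratios.
\<close>

definition ratio :: "complex measure \<Rightarrow> real \<times> real \<Rightarrow> ennreal" where
  "ratio \<mu> I = emeasure \<mu> (qbox I) / emeasure \<nu> (qbox I)"

lemma ratio_finite:
  assumes "emeasure \<mu> (qbox I) < top"
  shows "ratio \<mu> I < top"
proof (cases "fst I < snd I")
  case True
  then show ?thesis
    using assms qbox_pos[of I] by (auto simp: ratio_def less_top[symmetric] ennreal_divide_eq_top_iff)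
next
  case False
  then have "qbox I = {}" by (auto simp: qbox_def)
  then show ?thesis by (simp add: ratio_def)
qed

lemma less_ratioD:
  assumes "t < ratio \<mu> I"
  shows "t * emeasure \<nu> (qbox I) \<le> emeasure \<mu> (qbox I)"
proof (cases "emeasure \<nu> (qbox I) = 0")
  case False
  have "t * emeasure \<nu> (qbox I) \<le> ratio \<mu> I * emeasure \<nu> (qbox I)"
    using assms by (intro mult_right_mono) auto
  also have "\<dots> = emeasure \<mu> (qbox I)"
    using False qbox_finite[of I] by (simp add: ratio_def ennreal_divide_times)
  finally show ?thesis .
qed simp

text \<open>
  The boxes making up the level set are those with \<open>\<mu>(Q) > t \<nu>(Q)\<close>. For the disjoint ones selected
  by the covering lemma the \<open>\<mu>\<close>-masses add up inside the level set, and the \<open>\<nu>\<close>-masses of their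
  triples dominate the \<open>\<nu>\<close>-mass of the level set. The level set also appears on the right-hand
  side, which is what makes integration against powers of \<open>t\<close> possible.
\<close>

lemma weak_type:
  assumes F: "finite F" and mu: "\<And>I. qbox I \<in> sets \<mu>"
  shows "t * emeasure \<nu> {z. t < maxop F (ratio \<mu>) z} \<le> D * emeasure \<mu> {z. t < maxop F (ratio \<mu>) z}"
proof -
  define E where "E = {I\<in>F. t < ratio \<mu> I}"
  have lev: "{z. t < maxop F (ratio \<mu>) z} = (\<Union>I\<in>E. qbox I)"
    by (simp add: level_set_maxop E_def)
  have "finite E" using F by (simp add: E_def)
  from vitali_qbox[OF this] obtain G where G: "G \<subseteq> E" "disjoint_family_on qbox G"
    "\<forall>I\<in>E. \<exists>J\<in>G. qbox I \<subseteq> qbox (triple J)" by blast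
  have "finite G" using \<open>finite E\<close> G(1) by (rule finite_subset[rotated])
  have "emeasure \<nu> (\<Union>I\<in>E. qbox I) \<le> emeasure \<nu> (\<Union>J\<in>G. qbox (triple J))"
    using G(3) by (intro emeasure_mono sets.finite_UN \<open>finite G\<close> qbox_sets) blast
  also have "\<dots> \<le> (\<Sum>J\<in>G. emeasure \<nu> (qbox (triple J)))"
    by (intro emeasure_subadditive_finite \<open>finite G\<close> image_subsetI qbox_sets)
  also have "\<dots> \<le> (\<Sum>J\<in>G. D * emeasure \<nu> (qbox J))"
    by (intro sum_mono doubling)
  finally have "t * emeasure \<nu> (\<Union>I\<in>E. qbox I) \<le> t * (\<Sum>J\<in>G. D * emeasure \<nu> (qbox J))"
    by (intro mult_left_mono) auto
  also have "\<dots> = D * (\<Sum>J\<in>G. t * emeasure \<nu> (qbox J))"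
    by (simp add: sum_distrib_left ac_simps)
  also have "\<dots> \<le> D * (\<Sum>J\<in>G. emeasure \<mu> (qbox J))"
    using G(1) by (intro mult_left_mono sum_mono less_ratioD) (auto simp: E_def)
  also have "(\<Sum>J\<in>G. emeasure \<mu> (qbox J)) = emeasure \<mu> (\<Union>J\<in>G. qbox J)"
    by (intro sum_emeasure G(2) \<open>finite G\<close> image_subsetI mu)
  also have "\<dots> \<le> emeasure \<mu> (\<Union>I\<in>E. qbox I)"
    using G(1) by (intro emeasure_mono sets.finite_UN \<open>finite E\<close> mu) blast
  finally show ?thesis
    unfolding lev by (auto simp: mult_left_mono)
qed

text \<open>
  The counterpart of the weak-type estimate with the roles of the measures exchanged. For a selected
  box \<open>J\<close>, the ratio of the triple of \<open>J\<close> is a lower bound for \<open>K\<close> on \<open>J\<close>, hence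
  \<open>\<mu>(triple J) \<le> D \<nu>(J) inf\<^sub>J K \<le> D \<integral>\<^sub>J K d\<nu>\<close>, and the selected boxes are disjoint.
\<close>

lemma emeasure_UN_qbox_le:
  assumes F: "finite F" "\<And>I. I \<in> F \<Longrightarrow> fst I < snd I" and mu: "\<And>I. qbox I \<in> sets \<mu>"
    and K: "K \<in> borel_measurable \<nu>"
    and ratio_le: "\<And>I z. fst I < snd I \<Longrightarrow> z \<in> qbox I \<Longrightarrow> ratio \<mu> I \<le> K z"
  shows "emeasure \<mu> (\<Union>I\<in>F. qbox I) \<le> D * (\<integral>\<^sup>+z. K z * indicator (\<Union>I\<in>F. qbox I) z \<partial>\<nu>)"
proof -
  from vitali_qbox[OF F(1)] obtain G where G: "G \<subseteq> F" "disjoint_family_on qbox G"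
    "\<forall>I\<in>F. \<exists>J\<in>G. qbox I \<subseteq> qbox (triple J)" by blast
  have "finite G" using F(1) G(1) by (rule finite_subset[rotated])
  have box: "emeasure \<mu> (qbox (triple J)) \<le> D * emeasure (density \<nu> K) (qbox J)" if "J \<in> G" for J
  proof -
    have J: "fst J < snd J" "fst (triple J) < snd (triple J)"
      using F(2) G(1) that by (auto simp: triple_def)
    have sub: "qbox J \<subseteq> qbox (triple J)"
      using J by (intro qbox_mono) (auto simp: triple_def)
    have "emeasure \<mu> (qbox (triple J)) = ratio \<mu> (triple J) * emeasure \<nu> (qbox (triple J))"
      using qbox_pos[OF J(2)] qbox_finite[of "triple J"]
      by (simp add: ratio_def ennreal_divide_times)
    also have "\<dots> \<le> ratio \<mu> (triple J) * (D * emeasure \<nu> (qbox J))"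
      by (intro mult_left_mono doubling) auto
    also have "\<dots> = D * (\<integral>\<^sup>+z. ratio \<mu> (triple J) * indicator (qbox J) z \<partial>\<nu>)"
      by (simp only: nn_integral_cmult_indicator[OF qbox_sets] mult.left_commute)
    also have "\<dots> \<le> D * (\<integral>\<^sup>+z. K z * indicator (qbox J) z \<partial>\<nu>)"
      using sub ratio_le[OF J(2)]
      by (intro mult_left_mono nn_integral_mono) (auto simp: indicator_def)
    also have "\<dots> = D * emeasure (density \<nu> K) (qbox J)"
      using K qbox_sets by (simp add: emeasure_density)
    finally show ?thesis .
  qed
  have "emeasure \<mu> (\<Union>I\<in>F. qbox I) \<le> emeasure \<mu> (\<Union>J\<in>G. qbox (triple J))"
    using G(3) by (intro emeasure_mono sets.finite_UN \<open>finite G\<close> mu) blast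
  also have "\<dots> \<le> (\<Sum>J\<in>G. emeasure \<mu> (qbox (triple J)))"
    by (intro emeasure_subadditive_finite \<open>finite G\<close> image_subsetI mu)
  also have "\<dots> \<le> (\<Sum>J\<in>G. D * emeasure (density \<nu> K) (qbox J))"
    by (intro sum_mono box)
  also have "\<dots> = D * (\<Sum>J\<in>G. emeasure (density \<nu> K) (qbox J))"
    by (simp add: sum_distrib_left)
  also have "(\<Sum>J\<in>G. emeasure (density \<nu> K) (qbox J)) = emeasure (density \<nu> K) (\<Union>J\<in>G. qbox J)"
    using qbox_sets by (intro sum_emeasure G(2) \<open>finite G\<close> image_subsetI) (simp only: sets_density)
  also have "\<dots> \<le> emeasure (density \<nu> K) (\<Union>I\<in>F. qbox I)"
    unfolding sets_density using G(1)
    by (intro emeasure_mono UN_mono subset_refl) (simp_all add: sets.finite_UN F(1) qbox_sets)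
  also have "\<dots> = (\<integral>\<^sup>+z. K z * indicator (\<Union>I\<in>F. qbox I) z \<partial>\<nu>)"
    by (intro emeasure_density K sets.finite_UN F(1) qbox_sets)
  finally show ?thesis by (simp add: mult_left_mono)
qed

section \<open>Strong-type estimates\<close>

lemma borel_measurable_maxop_finite:
  assumes "finite F"
  shows "maxop F c \<in> borel_measurable \<nu>"
  by (intro borel_measurable_maxop countable_finite assms qbox_sets)

text \<open>
  Finite families give bounded functions supported in sets of finite measure. This is the a priori
  finiteness that absorbing a power of the integral requires.
\<close>

lemma nn_integral_maxop_finite:
  assumes F: "finite F" "\<And>I. I \<in> F \<Longrightarrow> c I < top" and a: "0 < a"
  shows "(\<integral>\<^sup>+z. epowr (maxop F c z) a \<partial>\<nu>) < top"
proof -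
  have "(\<integral>\<^sup>+z. epowr (maxop F c z) a \<partial>\<nu>)
      \<le> (\<integral>\<^sup>+z. (\<Sum>I\<in>F. epowr (c I) a * indicator (qbox I) z) \<partial>\<nu>)"
    unfolding epowr_maxop[OF a] by (intro nn_integral_mono maxop_le_sum F)
  also have "\<dots> = (\<Sum>I\<in>F. epowr (c I) a * emeasure \<nu> (qbox I))"
    using qbox_sets
    by (subst nn_integral_sum) (simp_all add: nn_integral_cmult_indicator borel_measurable_indicator
        borel_measurable_times_ennreal)
  also have "\<dots> < top"
    using F a by (simp add: ennreal_mult_less_top qbox_finite)
  finally show ?thesis .
qed

text \<open>
  The weak-type estimate, multiplied by \<open>(a + 1) t\<^bsup>a-1\<^esup>\<close> and integrated over all levels; the
  factor \<open>(a + 1) / a\<close> is the quotient of the two layer cake constants.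
\<close>

lemma nn_integral_maxop_ratio_le:
  assumes F: "finite F" and mu: "space \<mu> = uhp" "\<And>I. qbox I \<in> sets \<mu>"
    and fin: "\<And>I. emeasure \<mu> (qbox I) < top" and a: "0 < a"
  shows "(\<integral>\<^sup>+z. epowr (maxop F (ratio \<mu>) z) (a + 1) \<partial>\<nu>)
    \<le> D * ennreal ((a + 1) / a) * (\<integral>\<^sup>+z. epowr (maxop F (ratio \<mu>) z) a \<partial>\<mu>)"
proof -
  define S where "S = maxop F (ratio \<mu>)"
  have meas: "S \<in> borel_measurable \<nu>" "S \<in> borel_measurable \<mu>"
    unfolding S_def by (intro borel_measurable_maxop countable_finite F qbox_sets mu)+
  note [measurable] = meas(2)
  have S_fin: "S z < top" for z
    unfolding S_def by (intro maxop_less_top F ratio_finite fin)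
  have lev: "{z. t < S z} \<in> sets \<nu>" "{z. t < S z} \<in> sets \<mu>" for t
    unfolding S_def level_set_maxop by (intro sets.finite_UN qbox_sets mu; simp add: F)+
  have "(\<integral>\<^sup>+z. epowr (S z) (a + 1) \<partial>\<nu>)
    = (\<integral>\<^sup>+t. ennreal ((a + 1) * t powr (a + 1 - 1)) * indicator {0..} t * emeasure \<nu> {z. ennreal t < S z} \<partial>lborel)"
    using nn_integral_layer_cake[OF sigma_finite_nu, of "a + 1" S "\<lambda>_. 1"] a S_fin meas
    by (simp add: lev)
  also have "\<dots> \<le> (\<integral>\<^sup>+t. D * ennreal ((a + 1) / a) *
      (ennreal (a * t powr (a - 1)) * indicator {0..} t * emeasure \<mu> {z. ennreal t < S z}) \<partial>lborel)"
  proof (intro nn_integral_mono)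
    fix t :: real
    show "ennreal ((a + 1) * t powr (a + 1 - 1)) * indicator {0..} t * emeasure \<nu> {z. ennreal t < S z}
      \<le> D * ennreal ((a + 1) / a) *
      (ennreal (a * t powr (a - 1)) * indicator {0..} t * emeasure \<mu> {z. ennreal t < S z})"
    proof (cases "0 < t")
      case True
      have "ennreal ((a + 1) * t powr (a + 1 - 1)) * emeasure \<nu> {z. ennreal t < S z}
          = ennreal ((a + 1) * t powr (a - 1)) * (ennreal t * emeasure \<nu> {z. ennreal t < S z})"
        using a True by (simp add: powr_diff ennreal_mult[symmetric] mult.assoc[symmetric])
      also have "\<dots> \<le> ennreal ((a + 1) * t powr (a - 1)) * (D * emeasure \<mu> {z. ennreal t < S z})"
        unfolding S_def by (intro mult_left_mono weak_type F mu) auto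
      also have "(a + 1) * t powr (a - 1) = ((a + 1) / a) * (a * t powr (a - 1))"
        using a by simp
      also have "ennreal \<dots> = ennreal ((a + 1) / a) * ennreal (a * t powr (a - 1))"
        using a by (intro ennreal_mult) auto
      finally show ?thesis
        using True by (simp add: mult_ac)
    qed (use a in \<open>cases "t = 0"; simp\<close>)
  qed
  also have "\<dots> = D * ennreal ((a + 1) / a) *
      (\<integral>\<^sup>+t. ennreal (a * t powr (a - 1)) * indicator {0..} t * emeasure \<mu> {z. ennreal t < S z} \<partial>lborel)"
  proof (rule nn_integral_cmult)
    interpret sigma_finite_measure \<mu>
      by (intro sigma_finite_measure_qbox mu fin)
    have "(\<lambda>t. \<integral>\<^sup>+z. indicator {z. ennreal t < S z} z \<partial>\<mu>) \<in> borel_measurable lborel"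
      by measurable
    then show "(\<lambda>t. ennreal (a * t powr (a - 1)) * indicator {0..} t * emeasure \<mu> {z. ennreal t < S z})
        \<in> borel_measurable lborel"
      by (simp add: lev)
  qed
  also have "(\<integral>\<^sup>+t. ennreal (a * t powr (a - 1)) * indicator {0..} t * emeasure \<mu> {z. ennreal t < S z} \<partial>lborel)
      = (\<integral>\<^sup>+z. epowr (S z) a \<partial>\<mu>)"
    using nn_integral_layer_cake[OF sigma_finite_measure_qbox[OF mu fin] a meas(2), of "\<lambda>_. 1"] S_fin
    by (simp add: lev)
  finally show ?thesis by (simp add: S_def)
qed

text \<open>
  On superlevel sets of a supremum over boxes, though in general not on other sets, \<open>\<mu>\<close> is dominated
  by \<open>D K d\<nu>\<close>. By the layer cake formula this carries over to integrals of powers of the supremum.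
\<close>

lemma nn_integral_maxop_le_density:
  assumes F: "finite F" "\<And>I. I \<in> F \<Longrightarrow> fst I < snd I \<and> c I < top" and a: "0 < a"
    and mu: "space \<mu> = uhp" "\<And>I. qbox I \<in> sets \<mu>" and fin: "\<And>I. emeasure \<mu> (qbox I) < top"
    and K: "K \<in> borel_measurable \<nu>"
    and ratio_le: "\<And>I z. fst I < snd I \<Longrightarrow> z \<in> qbox I \<Longrightarrow> ratio \<mu> I \<le> K z"
  shows "(\<integral>\<^sup>+z. epowr (maxop F c z) a \<partial>\<mu>) \<le> D * (\<integral>\<^sup>+z. epowr (maxop F c z) a * K z \<partial>\<nu>)"
proof -
  define S where "S = maxop F c"
  have meas: "S \<in> borel_measurable \<nu>" "S \<in> borel_measurable \<mu>"
    unfolding S_def by (intro borel_measurable_maxop countable_finite F qbox_sets mu)+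
  note [measurable] = meas(1) K
  have S_fin: "S z < top" for z
    unfolding S_def using F by (intro maxop_less_top) auto
  have lev: "{z. t < S z} \<in> sets \<nu>" "{z. t < S z} \<in> sets \<mu>" for t
    unfolding S_def level_set_maxop by (intro sets.finite_UN qbox_sets mu; simp add: F)+
  have lev_le: "emeasure \<mu> {z. t < S z} \<le> D * (\<integral>\<^sup>+z. K z * indicator {z. t < S z} z \<partial>\<nu>)" for t
    unfolding S_def level_set_maxop using F ratio_le
    by (intro emeasure_UN_qbox_le mu K) auto
  have "(\<integral>\<^sup>+z. epowr (S z) a \<partial>\<mu>)
      = (\<integral>\<^sup>+t. ennreal (a * t powr (a - 1)) * indicator {0..} t * emeasure \<mu> {z. ennreal t < S z} \<partial>lborel)"
    using nn_integral_layer_cake[OF sigma_finite_measure_qbox[OF mu fin] a meas(2), of "\<lambda>_. 1"] S_fin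
    by (simp add: lev)
  also have "\<dots> \<le> (\<integral>\<^sup>+t. D * (ennreal (a * t powr (a - 1)) * indicator {0..} t
      * (\<integral>\<^sup>+z. K z * indicator {z. ennreal t < S z} z \<partial>\<nu>)) \<partial>lborel)"
    by (intro nn_integral_mono order_trans[OF mult_left_mono[OF lev_le]]) (auto simp: mult_ac)
  also have "\<dots> = D * (\<integral>\<^sup>+t. ennreal (a * t powr (a - 1)) * indicator {0..} t
      * (\<integral>\<^sup>+z. K z * indicator {z. ennreal t < S z} z \<partial>\<nu>) \<partial>lborel)"
  proof (rule nn_integral_cmult)
    interpret sigma_finite_measure \<nu> by (rule sigma_finite_nu)
    show "(\<lambda>t. ennreal (a * t powr (a - 1)) * indicator {0..} t
        * (\<integral>\<^sup>+z. K z * indicator {z. ennreal t < S z} z \<partial>\<nu>)) \<in> borel_measurable lborel"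
      by measurable
  qed
  also have "\<dots> = D * (\<integral>\<^sup>+z. epowr (S z) a * K z \<partial>\<nu>)"
    by (subst nn_integral_layer_cake[OF sigma_finite_nu a meas(1) K]) (simp_all add: S_fin)
  finally show ?thesis by (simp add: S_def)
qed

subsection \<open>The maximal theorem\<close>

definition average :: "(complex \<Rightarrow> ennreal) \<Rightarrow> real \<times> real \<Rightarrow> ennreal" where
  "average f I = (\<integral>\<^sup>+z. f z * indicator (qbox I) z \<partial>\<nu>) / emeasure \<nu> (qbox I)"

lemma average_eq_ratio: "f \<in> borel_measurable \<nu> \<Longrightarrow> average f = ratio (density \<nu> f)"
  by (auto simp: average_def ratio_def emeasure_density qbox_sets)

lemma nn_integral_qbox_finite:
  assumes p: "1 < p" and f: "f \<in> borel_measurable \<nu>" "(\<integral>\<^sup>+z. epowr (f z) p \<partial>\<nu>) < top"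
  shows "(\<integral>\<^sup>+z. f z * indicator (qbox I) z \<partial>\<nu>) < top"
proof -
  define p' where "p' = p / (p - 1)"
  have p': "1 < p'" "1 / p + 1 / p' = 1" "0 < p'"
    using p by (auto simp: p'_def field_simps)
  have "(\<integral>\<^sup>+z. epowr (indicator (qbox I) z) p' \<partial>\<nu>) = (\<integral>\<^sup>+z. indicator (qbox I) z \<partial>\<nu>)"
    using p' epowr_ennreal[of p' 1] by (intro nn_integral_cong) (auto simp: indicator_def)
  then have "(\<integral>\<^sup>+z. f z * indicator (qbox I) z \<partial>\<nu>)
      \<le> epowr (\<integral>\<^sup>+z. epowr (f z) p \<partial>\<nu>) (1 / p) * epowr (emeasure \<nu> (qbox I)) (1 / p')"
    using nn_integral_Hoelder[OF p p'(1,2) f(1), of "indicator (qbox I)"] qbox_sets[of I]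
    by simp
  also have "\<dots> < top"
    using p p' f qbox_finite[of I] by (simp add: ennreal_mult_less_top)
  finally show ?thesis .
qed

lemma average_finite:
  assumes p: "1 < p" and f: "f \<in> borel_measurable \<nu>" "(\<integral>\<^sup>+z. epowr (f z) p \<partial>\<nu>) < top"
  shows "average f I < top"
  using nn_integral_qbox_finite[OF p f]
  by (simp add: average_eq_ratio f emeasure_density qbox_sets ratio_finite)

text \<open>
  Doob's argument. The averages of \<open>f\<close> are the ratios of the measure \<open>f d\<nu>\<close>, so with
  \<open>a = p - 1\<close> the previous estimates give \<open>\<integral> S\<^sup>p d\<nu> \<le> B \<integral> S\<^bsup>p-1\<^esup> f d\<nu>\<close>. Hoelder's inequality
  splits off \<open>\<parallel>f\<parallel>\<^sub>p\<close>, and the power of \<open>\<integral> S\<^sup>p d\<nu>\<close> is absorbed.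
\<close>

lemma maximal_theorem_finite:
  assumes p: "1 < p" and f: "f \<in> borel_measurable \<nu>" "(\<integral>\<^sup>+z. epowr (f z) p \<partial>\<nu>) < top"
    and F: "finite F"
  shows "(\<integral>\<^sup>+z. epowr (maxop F (average f) z) p \<partial>\<nu>)
      \<le> epowr (D * ennreal (p / (p - 1))) p * (\<integral>\<^sup>+z. epowr (f z) p \<partial>\<nu>)"
proof -
  define S where "S = maxop F (average f)"
  define X where "X = (\<integral>\<^sup>+z. epowr (S z) p \<partial>\<nu>)"
  define Y where "Y = (\<integral>\<^sup>+z. epowr (f z) p \<partial>\<nu>)"
  define p' where "p' = p / (p - 1)"
  have p': "1 < p'" "1 / p' + 1 / p = 1" "1 / p' = 1 - 1 / p" "(p - 1) * p' = p"
    using p by (auto simp: p'_def field_simps)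
  have [measurable]: "S \<in> borel_measurable \<nu>" "f \<in> borel_measurable \<nu>"
    unfolding S_def by (intro borel_measurable_maxop_finite F f)+
  have X_fin: "X < top"
    unfolding X_def S_def using p by (intro nn_integral_maxop_finite F average_finite[OF p] f) auto
  have "X \<le> D * ennreal (p / (p - 1)) * (\<integral>\<^sup>+z. epowr (S z) (p - 1) \<partial>density \<nu> f)"
    using nn_integral_maxop_ratio_le[of F "density \<nu> f" "p - 1"] p
    by (simp add: X_def S_def average_eq_ratio F f space_nu qbox_sets emeasure_density
          nn_integral_qbox_finite[OF p f])
  also have "\<dots> \<le> D * ennreal (p / (p - 1)) * (epowr X (1 - 1 / p) * epowr Y (1 / p))"
  proof (rule mult_left_mono)
    have "(\<integral>\<^sup>+z. epowr (S z) (p - 1) \<partial>density \<nu> f) = (\<integral>\<^sup>+z. epowr (S z) (p - 1) * f z \<partial>\<nu>)"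
      by (subst nn_integral_density) (auto simp: mult.commute)
    also have "\<dots> \<le> epowr (\<integral>\<^sup>+z. epowr (epowr (S z) (p - 1)) p' \<partial>\<nu>) (1 / p') * epowr Y (1 / p)"
      unfolding Y_def by (intro nn_integral_Hoelder p' p) measurable
    also have "(\<integral>\<^sup>+z. epowr (epowr (S z) (p - 1)) p' \<partial>\<nu>) = X"
      using p p' by (simp add: X_def epowr_epowr)
    finally show "(\<integral>\<^sup>+z. epowr (S z) (p - 1) \<partial>density \<nu> f) \<le> epowr X (1 - 1 / p) * epowr Y (1 / p)"
      by (simp add: p'(3))
  qed simp
  finally have "X \<le> (D * ennreal (p / (p - 1)) * epowr Y (1 / p)) * epowr X (1 - 1 / p)"
    by (simp add: mult_ac)
  from le_epowr_absorb[OF this X_fin] p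
  have "X \<le> epowr (D * ennreal (p / (p - 1)) * epowr Y (1 / p)) p"
    by simp
  also have "\<dots> = epowr (D * ennreal (p / (p - 1))) p * Y"
    using p by (simp add: epowr_mult epowr_epowr)
  finally show ?thesis by (simp add: X_def Y_def S_def)
qed

subsection \<open>Carleson embeddings\<close>

text \<open>
  Sufficiency: \<open>\<integral> (M f)\<^sup>q d\<mu> \<le> D \<integral> (M f)\<^sup>q K d\<nu>\<close>, and \<open>s\<close> is the exponent dual to \<open>p / q\<close>, so
  Hoelder's inequality leaves \<open>\<parallel>M f\<parallel>\<^sub>p\<^sup>q\<close> and \<open>\<parallel>K\<parallel>\<^sub>s\<close>.
\<close>

lemma embedding_if_ratio_in_L:
  assumes pq: "1 < q" "q < p" "s = p / (p - q)"
    and mu: "space \<mu> = uhp" "\<And>I. qbox I \<in> sets \<mu>" and fin: "\<And>I. emeasure \<mu> (qbox I) < top"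
    and K: "K \<in> borel_measurable \<nu>"
    and ratio_le: "\<And>I z. fst I < snd I \<Longrightarrow> z \<in> qbox I \<Longrightarrow> ratio \<mu> I \<le> K z"
    and f: "f \<in> borel_measurable \<nu>" "(\<integral>\<^sup>+z. epowr (f z) p \<partial>\<nu>) < top"
  shows "(\<integral>\<^sup>+z. epowr (maxop rat_intervals (average f) z) q \<partial>\<mu>)
    \<le> D * epowr (\<integral>\<^sup>+z. epowr (K z) s \<partial>\<nu>) (1 / s) * epowr (D * ennreal (p / (p - 1))) q
        * epowr (\<integral>\<^sup>+z. epowr (f z) p \<partial>\<nu>) (q / p)"
proof (rule nn_integral_maxop_le)
  fix F assume F: "finite F" "F \<subseteq> rat_intervals"
  define S where "S = maxop F (average f)"
  define L where "L = (\<integral>\<^sup>+z. epowr (K z) s \<partial>\<nu>)"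
  define Y where "Y = (\<integral>\<^sup>+z. epowr (f z) p \<partial>\<nu>)"
  have [measurable]: "S \<in> borel_measurable \<nu>"
    unfolding S_def by (intro borel_measurable_maxop_finite F)
  have s: "1 < s" "1 < p / q" "1 / (p / q) + 1 / s = 1" "1 / (p / q) = q / p" "1 < p"
    using pq(1,2) unfolding pq(3) by (simp_all add: field_simps)
  have "(\<integral>\<^sup>+z. epowr (S z) q \<partial>\<mu>) \<le> D * (\<integral>\<^sup>+z. epowr (S z) q * K z \<partial>\<nu>)"
    unfolding S_def using F pq average_finite[OF s(5) f]
    by (intro nn_integral_maxop_le_density mu fin K ratio_le) (auto simp: rat_intervals_def)
  also have "\<dots> \<le> D * (epowr (\<integral>\<^sup>+z. epowr (epowr (S z) q) (p / q) \<partial>\<nu>) (q / p) * epowr L (1 / s))"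
    unfolding L_def s(4)[symmetric] by (intro mult_left_mono nn_integral_Hoelder s K) simp_all
  also have "(\<integral>\<^sup>+z. epowr (epowr (S z) q) (p / q) \<partial>\<nu>) = (\<integral>\<^sup>+z. epowr (S z) p \<partial>\<nu>)"
    using pq by (simp add: epowr_epowr)
  also have "epowr (\<integral>\<^sup>+z. epowr (S z) p \<partial>\<nu>) (q / p)
      \<le> epowr (epowr (D * ennreal (p / (p - 1))) p * Y) (q / p)"
    unfolding S_def Y_def using pq by (intro epowr_mono maximal_theorem_finite f F) auto
  also have "\<dots> = epowr (D * ennreal (p / (p - 1))) q * epowr Y (q / p)"
    using pq by (simp add: epowr_mult epowr_epowr)
  finally have "(\<integral>\<^sup>+z. epowr (S z) q \<partial>\<mu>)
      \<le> D * (epowr (D * ennreal (p / (p - 1))) q * epowr Y (q / p) * epowr L (1 / s))"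
    by (simp add: mult_left_mono mult_right_mono)
  then show "(\<integral>\<^sup>+z. epowr (maxop F (average f) z) q \<partial>\<mu>)
    \<le> D * epowr L (1 / s) * epowr (D * ennreal (p / (p - 1))) q * epowr Y (q / p)"
    by (simp add: S_def mult_ac)
qed (use pq mu countable_rat_intervals in auto)

lemma ex_rat_interval:
  obtains J where "J \<in> rat_intervals" "qbox I \<subseteq> qbox J"
proof -
  obtain n where n: "\<bar>fst I\<bar> + \<bar>snd I\<bar> < real n" using reals_Archimedean2 by blast
  then have "(- real n, real n) \<in> rat_intervals" "qbox I \<subseteq> qbox (- real n, real n)"
    by (auto simp: rat_intervals_def) (rule subsetD[OF qbox_mono], auto)
  then show thesis by (rule that)
qed

lemma average_indicator: "fst I < snd I \<Longrightarrow> average (indicator (qbox I)) I = 1"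
  using qbox_pos[of I] qbox_finite[of I]
  by (simp add: average_def qbox_sets indicator_inter_arith[symmetric])

text \<open>
  Necessity, by testing on powers of \<open>K\<^sub>\<mu>\<close> itself. The exponent \<open>1 / (p - q)\<close> is chosen such that
  \<open>\<integral> g\<^sup>p d\<nu>\<close> is \<open>X = \<integral> S\<^sup>s d\<nu>\<close>, while the left-hand side is at least \<open>\<integral> g\<^sup>q d\<mu>\<close>, which by the
  strong-type estimate dominates a multiple of the same \<open>X\<close>; the embedding then reads
  \<open>X \<le> B X\<^bsup>q/p\<^esup>\<close>. Truncating to finite families keeps \<open>X\<close> finite.
\<close>

lemma ratio_in_L_if_embedding:
  assumes pq: "1 < q" "q < p" "s = p / (p - q)"
    and mu: "space \<mu> = uhp" "\<And>I. qbox I \<in> sets \<mu>"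
    and C: "C < top"
    and emb: "\<And>g. g \<in> borel_measurable \<nu> \<Longrightarrow> (\<And>z. g z < top) \<Longrightarrow> (\<integral>\<^sup>+z. epowr (g z) p \<partial>\<nu>) < top \<Longrightarrow>
      (\<integral>\<^sup>+z. epowr (maxop rat_intervals (average g) z) q \<partial>\<mu>)
        \<le> C * epowr (\<integral>\<^sup>+z. epowr (g z) p \<partial>\<nu>) (q / p)"
  shows "(\<integral>\<^sup>+z. epowr (maxop rat_intervals (ratio \<mu>) z) s \<partial>\<nu>) < top"
proof -
  have p: "0 < p" "0 < q" using pq by auto
  \<comment> \<open>Test functions are indicators of boxes: the maximal function of such an indicator is at least \<open>1\<close> on that box.\<close>
  have fin_rat: "emeasure \<mu> (qbox I) < top" if I: "I \<in> rat_intervals" for I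
  proof -
    have eq: "epowr (indicator (qbox I) z) p = indicator (qbox I) z" for z
      using p epowr_ennreal[of p 1] by (auto simp: indicator_def)
    have ind: "indicator (qbox I) z < (top :: ennreal)" for z
      by (simp add: indicator_def)
    have "emeasure \<mu> (qbox I) = (\<integral>\<^sup>+z. indicator (qbox I) z \<partial>\<mu>)"
      using mu by simp
    also have "\<dots> \<le> (\<integral>\<^sup>+z. epowr (maxop rat_intervals (average (indicator (qbox I))) z) q \<partial>\<mu>)"
    proof (rule nn_integral_mono)
      fix z
      have "1 \<le> maxop rat_intervals (average (indicator (qbox I))) z" if "z \<in> qbox I"
        using maxop_upper[OF I that, of "average (indicator (qbox I))"] average_indicator[of I] I
        by (simp add: rat_intervals_def)
      then show "indicator (qbox I) z \<le> epowr (maxop rat_intervals (average (indicator (qbox I))) z) q"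
        using epowr_mono[OF p(2), of 1] epowr_ennreal[OF p(2), of 1] by (auto simp: indicator_def)
    qed
    also have "\<dots> \<le> C * epowr (emeasure \<nu> (qbox I)) (q / p)"
      using emb[OF borel_measurable_indicator[OF qbox_sets[of I]] ind] qbox_finite[of I]
      by (simp add: eq qbox_sets)
    also have "\<dots> < top"
      using C p qbox_finite[of I] by (simp add: ennreal_mult_less_top)
    finally show ?thesis .
  qed
  have fin: "emeasure \<mu> (qbox I) < top" for I
  proof -
    obtain J where J: "J \<in> rat_intervals" "qbox I \<subseteq> qbox J" by (rule ex_rat_interval)
    show ?thesis
      using emeasure_mono[OF J(2) mu(2)] fin_rat[OF J(1)] by (rule le_less_trans)
  qed
  define a where "a = q / (p - q)"
  have a: "0 < a" "a + 1 = s" "1 / (p - q) * q = a" "1 / (p - q) * p = s" "0 < 1 / (p - q)" "0 < s"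
    using pq(1,2) by (simp_all add: a_def pq(3) field_simps)
  define B where "B = D * ennreal (s / a) * C"
  have "(\<integral>\<^sup>+z. epowr (maxop rat_intervals (ratio \<mu>) z) s \<partial>\<nu>) \<le> epowr B s"
  proof (rule nn_integral_maxop_le)
    fix F assume F: "finite F" "F \<subseteq> rat_intervals"
    define S where "S = maxop F (ratio \<mu>)"
    define g where "g z = epowr (S z) (1 / (p - q))" for z
    define X where "X = (\<integral>\<^sup>+z. epowr (S z) s \<partial>\<nu>)"
    have [measurable]: "S \<in> borel_measurable \<nu>"
      unfolding S_def by (intro borel_measurable_maxop_finite F)
    have X_fin: "X < top"
      unfolding X_def S_def using a by (intro nn_integral_maxop_finite F ratio_finite fin)
    have g_top: "g z < top" for z
      using maxop_less_top[OF F(1) ratio_finite[OF fin]] a(5) by (simp add: g_def S_def)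
    have g_meas: "g \<in> borel_measurable \<nu>"
      unfolding g_def by measurable
    have gp: "(\<integral>\<^sup>+z. epowr (g z) p \<partial>\<nu>) = X"
      using a p by (simp add: g_def X_def epowr_epowr)
    have le: "epowr (S z) (1 / (p - q)) \<le> maxop rat_intervals (average g) z" for z
      unfolding S_def epowr_maxop[OF a(5)]
    proof (rule maxop_least)
      fix I assume I: "I \<in> F" "z \<in> qbox I"
      then have IR: "I \<in> rat_intervals" "fst I < snd I" using F(2) by (auto simp: rat_intervals_def)
      have "epowr (ratio \<mu> I) (1 / (p - q)) * emeasure \<nu> (qbox I)
          = (\<integral>\<^sup>+w. epowr (ratio \<mu> I) (1 / (p - q)) * indicator (qbox I) w \<partial>\<nu>)"
        by (rule nn_integral_cmult_indicator[symmetric, OF qbox_sets])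
      also have "\<dots> \<le> (\<integral>\<^sup>+w. g w * indicator (qbox I) w \<partial>\<nu>)"
        using maxop_upper[OF I(1)] a(5)
        by (intro nn_integral_mono) (auto simp: indicator_def g_def S_def intro!: epowr_mono)
      finally have "epowr (ratio \<mu> I) (1 / (p - q)) * emeasure \<nu> (qbox I) / emeasure \<nu> (qbox I) \<le> average g I"
        unfolding average_def by (rule divide_right_mono_ennreal)
      then have "epowr (ratio \<mu> I) (1 / (p - q)) \<le> average g I"
        using qbox_pos[OF IR(2)] qbox_finite[of I] by (simp add: ennreal_mult_divide_eq)
      also have "\<dots> \<le> maxop rat_intervals (average g) z"
        by (intro maxop_upper IR I)
      finally show "epowr (ratio \<mu> I) (1 / (p - q)) \<le> maxop rat_intervals (average g) z" .
    qed
    have "X \<le> D * ennreal (s / a) * (\<integral>\<^sup>+z. epowr (S z) a \<partial>\<mu>)"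
      using nn_integral_maxop_ratio_le[OF F(1) mu fin a(1)] by (simp add: X_def S_def a(2))
    also have "\<dots> \<le> D * ennreal (s / a) * (C * epowr X (q / p))"
    proof (rule mult_left_mono)
      have "(\<integral>\<^sup>+z. epowr (S z) a \<partial>\<mu>) = (\<integral>\<^sup>+z. epowr (epowr (S z) (1 / (p - q))) q \<partial>\<mu>)"
        using epowr_epowr[OF a(5) p(2)] a(3) by simp
      also have "\<dots> \<le> (\<integral>\<^sup>+z. epowr (maxop rat_intervals (average g) z) q \<partial>\<mu>)"
        by (intro nn_integral_mono epowr_mono p le)
      also have "\<dots> \<le> C * epowr X (q / p)"
        using emb[OF g_meas g_top] X_fin by (simp add: gp)
      finally show "(\<integral>\<^sup>+z. epowr (S z) a \<partial>\<mu>) \<le> C * epowr X (q / p)" .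
    qed simp
    finally have "X \<le> B * epowr X (1 - (1 - q / p))"
      by (simp add: B_def mult_ac)
    from le_epowr_absorb[OF this X_fin] pq
    have "X \<le> epowr B (1 / (1 - q / p))" by simp
    also have "1 / (1 - q / p) = s"
      using pq by (simp add: field_simps)
    finally show "(\<integral>\<^sup>+z. epowr (maxop F (ratio \<mu>) z) s \<partial>\<nu>) \<le> epowr B s"
      by (simp add: X_def S_def)
  qed (use a countable_rat_intervals qbox_sets in auto)
  also have "epowr B s < top"
    using a C D_finite by (simp add: B_def ennreal_mult_less_top)
  finally show ?thesis .
qed

end

section \<open>Interval boxes and the measure with density a weight\<close>

lemma intervalsE:
  assumes "I \<in> intervals"
  obtains a b where "a < b" "{a<..<b} \<subseteq> I" "I \<subseteq> {a..b}" "measure lborel I = b - a"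
proof -
  from assms have I: "is_interval I" "bounded I" "0 < measure lborel I"
    by (auto simp: intervals_def)
  then have ne: "I \<noteq> {}" by auto
  have bdd: "bdd_above I" "bdd_below I"
    using I(2) by (auto intro: bounded_imp_bdd_above bounded_imp_bdd_below)
  have sub: "I \<subseteq> {Inf I..Sup I}"
    using bdd by (auto intro: cInf_lower cSup_upper)
  have sup: "{Inf I<..<Sup I} \<subseteq> I"
  proof
    fix x assume "x \<in> {Inf I<..<Sup I}"
    then obtain y z where "y \<in> I" "y < x" "z \<in> I" "x < z"
      using cInf_less_iff[OF ne bdd(2)] less_cSup_iff[OF ne bdd(1)] by auto
    then show "x \<in> I"
      using I(1) by (meson mem_is_interval_1_I less_imp_le)
  qed
  have le: "Inf I \<le> Sup I"
    using ne sub by fastforce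
  have sets: "I \<in> sets lborel"
    using I(1) by (simp add: real_interval_borel_measurable)
  have "emeasure lborel I = ennreal (Sup I - Inf I)"
  proof (rule antisym)
    show "emeasure lborel I \<le> ennreal (Sup I - Inf I)"
      using emeasure_mono[OF sub, of lborel] le by simp
    show "ennreal (Sup I - Inf I) \<le> emeasure lborel I"
      using emeasure_mono[OF sup sets] le by simp
  qed
  then have meas: "measure lborel I = Sup I - Inf I"
    using le by (simp add: measure_def)
  with I(3) have "Inf I < Sup I" by simp
  from this sup sub meas show thesis by (rule that)
qed

lemma greaterThanLessThan_in_intervals:
  assumes "a < b"
  shows "{a<..<b} \<in> intervals" "Q_box {a<..<b} = qbox (a, b)"
  using assms by (auto simp: intervals_def Q_box_def qbox_def is_interval_convex_1)

lemma qbox_eq_box: "qbox I = box (Complex (fst I) 0) (Complex (snd I) (snd I - fst I))"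
  by (auto simp: qbox_def in_box_complex_iff)

lemma qbox_borel [measurable]: "qbox I \<in> sets borel"
  by (simp add: qbox_eq_box)

lemma uhp_borel [measurable]: "uhp \<in> sets borel"
  unfolding uhp_def by measurable

lemma Q_box_subset_uhp: "Q_box I \<subseteq> uhp"
  by (auto simp: Q_box_def uhp_def)

lemma Q_box_borel: "I \<in> intervals \<Longrightarrow> Q_box I \<in> sets borel"
proof -
  assume "I \<in> intervals"
  then have [measurable]: "I \<in> sets borel"
    by (simp add: intervals_def real_interval_borel_measurable)
  show ?thesis
    unfolding Q_box_def by measurable
qed

lemma emeasure_qbox:
  assumes "fst I < snd I"
  shows "emeasure lborel (qbox I) = ennreal ((snd I - fst I)\<^sup>2)"
  unfolding qbox_eq_box
  using assms by (subst emeasure_lborel_box) (auto simp: Basis_complex_def power2_eq_square)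

definition weight_measure :: "(complex \<Rightarrow> real) \<Rightarrow> complex measure" where
  "weight_measure \<omega> = density (lebesgue_on uhp) (\<lambda>z. ennreal (\<omega> z))"

lemma space_weight_measure: "space (weight_measure \<omega>) = uhp"
  by (simp add: weight_measure_def space_restrict_space)

lemma sets_weight_measure: "sets (weight_measure \<omega>) = sets (lebesgue_on uhp)"
  by (simp add: weight_measure_def)

lemma borel_subset_uhp_in_sets_weight_measure: "A \<in> sets borel \<Longrightarrow> A \<subseteq> uhp \<Longrightarrow> A \<in> sets (weight_measure \<omega>)"
  by (auto simp: sets_weight_measure sets_restrict_space_iff)

lemma qbox_in_sets_weight_measure: "qbox I \<in> sets (weight_measure \<omega>)"
  by (intro borel_subset_uhp_in_sets_weight_measure qbox_borel qbox_subset_uhp)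

text \<open>
  Local integrability makes \<open>\<omega>\<close> measurable on compact sets, and compact rectangles exhaust the upper
  half-plane.
\<close>

lemma weight_measurable:
  assumes "weight \<omega>"
  shows "\<omega> \<in> borel_measurable (lebesgue_on uhp)"
proof -
  define K where "K n = cbox (Complex (- real n) (1 / (real n + 1))) (Complex (real n) (real n))" for n
  have K: "compact (K n)" "K n \<subseteq> uhp" for n
    by (auto simp: K_def uhp_def in_cbox_complex_iff intro: less_le_trans[rotated])
  then have "\<omega> absolutely_integrable_on K n" for n
    using assms by (auto simp: weight_def)
  then have meas: "(\<lambda>z. indicator (K n) z *\<^sub>R \<omega> z) \<in> borel_measurable lebesgue" for n
    unfolding set_integrable_def by (rule borel_measurable_integrable)
  have lim: "(\<lambda>n. indicator (K n) z *\<^sub>R \<omega> z) \<longlonglongrightarrow> indicator uhp z *\<^sub>R \<omega> z" for z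
  proof (rule tendsto_eventually)
    show "\<forall>\<^sub>F n in sequentially. indicator (K n) z *\<^sub>R \<omega> z = indicator uhp z *\<^sub>R \<omega> z"
    proof (cases "z \<in> uhp")
      case True
      then have z: "0 < Im z" by (simp add: uhp_def)
      obtain N where N: "\<bar>Re z\<bar> + Im z + 1 / Im z < real N" using reals_Archimedean2 by blast
      have "z \<in> K n" if "n \<ge> N" for n
      proof -
        have n: "\<bar>Re z\<bar> + Im z + 1 / Im z < real n" using N that by linarith
        then have "1 / Im z < real n + 1" using z by linarith
        then have "1 / (real n + 1) < Im z" using z by (simp add: field_simps)
        moreover have "0 < 1 / Im z" using z by simp
        ultimately have "- real n \<le> Re z" "Re z \<le> real n" "1 / (real n + 1) \<le> Im z" "Im z \<le> real n"
          using n z by linarith+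
        then show ?thesis
          by (simp add: K_def in_cbox_complex_iff)
      qed
      then show ?thesis
        using True by (auto simp: eventually_sequentially intro!: exI[of _ N])
    next
      case False
      then have "z \<notin> K n" for n using K(2)[of n] by blast
      then show ?thesis using False by simp
    qed
  qed
  have "(\<lambda>z. indicator uhp z *\<^sub>R \<omega> z) \<in> borel_measurable lebesgue"
    by (rule borel_measurable_LIMSEQ_metric[OF meas lim])
  then show ?thesis
    by (subst borel_measurable_restrict_space_iff) auto
qed

lemma nn_integral_weight_measure:
  assumes w: "\<omega> \<in> borel_measurable (lebesgue_on uhp)" and F: "F \<in> borel_measurable (lebesgue_on uhp)"
  shows "(\<integral>\<^sup>+z. F z \<partial>weight_measure \<omega>) = (\<integral>\<^sup>+z. F z * ennreal (\<omega> z) * indicator uhp z \<partial>lebesgue)"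
  unfolding weight_measure_def using w F
  by (simp add: nn_integral_density nn_integral_restrict_space mult.commute[of "F _"])

lemma wmeasure_eq:
  assumes w: "\<omega> \<in> borel_measurable (lebesgue_on uhp)" and A: "A \<in> sets borel" "A \<subseteq> uhp"
  shows "wmeasure \<omega> A = emeasure (weight_measure \<omega>) A"
proof -
  have "emeasure (weight_measure \<omega>) A = (\<integral>\<^sup>+z. indicator A z \<partial>weight_measure \<omega>)"
    using A by (simp add: borel_subset_uhp_in_sets_weight_measure)
  also have "\<dots> = (\<integral>\<^sup>+z. indicator A z * ennreal (\<omega> z) * indicator uhp z \<partial>lebesgue)"
    using A by (intro nn_integral_weight_measure w borel_measurable_indicator) (auto simp: sets_restrict_space_iff)
  also have "\<dots> = wmeasure \<omega> A"
    unfolding wmeasure_def using A(2) by (intro nn_integral_cong) (auto simp: indicator_def)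
  finally show ?thesis ..
qed

lemma set_nn_integral_eq_weight_measure:
  assumes w: "\<omega> \<in> borel_measurable (lebesgue_on uhp)" and F: "F \<in> borel_measurable (lebesgue_on uhp)"
    and A: "A \<in> sets borel" "A \<subseteq> uhp"
  shows "(\<integral>\<^sup>+z\<in>A. F z * ennreal (\<omega> z) \<partial>lebesgue) = (\<integral>\<^sup>+z\<in>A. F z \<partial>weight_measure \<omega>)"
proof -
  have "(\<integral>\<^sup>+z\<in>A. F z \<partial>weight_measure \<omega>) = (\<integral>\<^sup>+z. (F z * indicator A z) * ennreal (\<omega> z) * indicator uhp z \<partial>lebesgue)"
    using A by (intro nn_integral_weight_measure w borel_measurable_times_ennreal F borel_measurable_indicator)
       (auto simp: sets_restrict_space_iff)
  also have "\<dots> = (\<integral>\<^sup>+z\<in>A. F z * ennreal (\<omega> z) \<partial>lebesgue)"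
    using A(2) by (intro nn_integral_cong) (auto simp: indicator_def)
  finally show ?thesis ..
qed

lemma wnorm_eq:
  assumes "\<omega> \<in> borel_measurable (lebesgue_on uhp)" "F \<in> borel_measurable (lebesgue_on uhp)"
  shows "wnorm r \<omega> F = epowr (\<integral>\<^sup>+z. epowr (F z) r \<partial>weight_measure \<omega>) (1 / r)"
  unfolding wnorm_def using assms by (subst nn_integral_weight_measure) auto

lemma null_weight_measure:
  assumes w: "\<omega> \<in> borel_measurable (lebesgue_on uhp)" and N: "negligible N" "N \<subseteq> uhp"
  shows "N \<in> null_sets (weight_measure \<omega>)"
proof -
  have "N \<in> null_sets (lebesgue_on uhp)"
    using N by (auto simp: negligible_iff_null_sets null_sets_restrict_space)
  moreover have "absolutely_continuous (lebesgue_on uhp) (weight_measure \<omega>)"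
    unfolding weight_measure_def using w by (intro absolutely_continuousI_density) auto
  ultimately show ?thesis by (auto simp: absolutely_continuous_def)
qed

section \<open>Reduction of the suprema to rational open intervals\<close>

lemma ennreal_inverse_antimono: "x \<le> y \<Longrightarrow> inverse y \<le> inverse (x :: ennreal)"
  by (cases "x = 0"; cases x; cases y) (auto simp: inverse_ennreal le_imp_inverse_le top_unique)

text \<open>
  Approximation of an interval from outside by rational open intervals, which are squeezed between
  \<open>I\<close> and its enlargements by \<open>1/(n+1)\<close> on both sides. The boxes over the latter decrease to the
  closure of \<open>Q\<^sub>I\<close> without its lower edge; this adds to \<open>Q\<^sub>I\<close> only parts of three lines, which are
  null sets, so \<open>\<nu>(Q\<^sub>I)\<close> is the limit of the measures by continuity from above. Passing to
  inverses covers the case \<open>\<nu>(Q\<^sub>I) = 0\<close> as well.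
\<close>

lemma weight_measure_Q_box:
  assumes w: "\<omega> \<in> borel_measurable (lebesgue_on uhp)" and I: "I \<in> intervals"
    and fin: "\<And>J. emeasure (weight_measure \<omega>) (qbox J) < top"
  obtains J where "\<And>n::nat. J n \<in> rat_intervals" "\<And>n. Q_box I \<subseteq> qbox (J n)"
    "inverse (wmeasure \<omega> (Q_box I)) \<le> (SUP n. inverse (emeasure (weight_measure \<omega>) (qbox (J n))))"
proof -
  from I obtain a b where ab: "a < b" "{a<..<b} \<subseteq> I" "I \<subseteq> {a..b}" "measure lborel I = b - a"
    by (rule intervalsE)
  define H where "H n = (a - 1 / real (Suc n), b + 1 / real (Suc n))" for n
  define R where "R = (\<Inter>n. qbox (H n))"
  have H: "qbox (H n) \<subseteq> qbox (H m)" if "m \<le> n" for m n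
    using that by (intro qbox_mono) (auto simp: H_def frac_le)
  have "\<exists>K. K \<in> rat_intervals \<and> Q_box I \<subseteq> qbox K \<and> qbox K \<subseteq> qbox (H n)" for n
  proof -
    obtain x where x: "x \<in> \<rat>" "a - 1 / real (Suc n) < x" "x < a"
      using Rats_dense_in_real[of "a - 1 / real (Suc n)" a] by auto
    obtain y where y: "y \<in> \<rat>" "b < y" "y < b + 1 / real (Suc n)"
      using Rats_dense_in_real[of b "b + 1 / real (Suc n)"] by auto
    have "(x, y) \<in> rat_intervals"
      using x y ab(1) by (simp add: rat_intervals_def)
    moreover have "Q_box I \<subseteq> qbox (x, y)"
      using ab(3) x y by (force simp: Q_box_def qbox_def ab(4))
    moreover have "qbox (x, y) \<subseteq> qbox (H n)"
      using x y by (intro qbox_mono) (auto simp: H_def)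
    ultimately show ?thesis by blast
  qed
  then obtain J where J: "J n \<in> rat_intervals" "Q_box I \<subseteq> qbox (J n)" "qbox (J n) \<subseteq> qbox (H n)" for n
    by metis
  define R where "R = (\<Inter>n. qbox (H n))"
  have R_uhp: "R \<subseteq> uhp"
    unfolding R_def using qbox_subset_uhp by blast
  have "R \<subseteq> cbox (Complex a 0) (Complex b (b - a))"
  proof
    fix z assume "z \<in> R"
    then have z: "a - 1 / real (Suc n) < Re z" "Re z < b + 1 / real (Suc n)" "0 < Im z"
      "Im z < b - a + 2 / real (Suc n)" for n
      by (auto simp: R_def H_def qbox_def algebra_simps)
    have lim: "(\<lambda>n. c / real (Suc n)) \<longlonglongrightarrow> 0" for c
      using LIMSEQ_Suc[OF lim_const_over_n[of c]] by simp
    have "a \<le> Re z"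
      using LIMSEQ_le_const2[OF tendsto_diff[OF tendsto_const lim], of a 1 "Re z"] z(1)
      by (auto intro: less_imp_le)
    moreover have "Re z \<le> b"
      using LIMSEQ_le_const[OF tendsto_add[OF tendsto_const lim], of "Re z" b 1] z(2)
      by (auto intro: less_imp_le)
    moreover have "Im z \<le> b - a"
      using LIMSEQ_le_const[OF tendsto_add[OF tendsto_const lim], of "Im z" "b - a" 2] z(4)
      by (auto intro: less_imp_le)
    ultimately show "z \<in> cbox (Complex a 0) (Complex b (b - a))"
      using z(3) by (auto simp: in_cbox_complex_iff)
  qed
  then have "R - qbox (a, b) \<subseteq> cbox (Complex a 0) (Complex b (b - a)) - box (Complex a 0) (Complex b (b - a))"
    by (auto simp: qbox_eq_box)
  then have "negligible (R - qbox (a, b))"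
    using negligible_frontier_interval by (rule negligible_subset[rotated])
  then have null: "R - qbox (a, b) \<in> null_sets (weight_measure \<omega>)"
    using R_uhp by (intro null_weight_measure w) auto
  have "qbox (a, b) \<subseteq> Q_box I"
    using ab by (auto simp: qbox_def Q_box_def)
  have "emeasure (weight_measure \<omega>) R \<le> emeasure (weight_measure \<omega>) (qbox (a, b) \<union> (R - qbox (a, b)))"
    by (intro emeasure_mono sets.Un qbox_in_sets_weight_measure null_setsD2[OF null]) auto
  also have "\<dots> = emeasure (weight_measure \<omega>) (qbox (a, b))"
    using null qbox_in_sets_weight_measure by (intro emeasure_Un_null_set)
  also have "\<dots> \<le> emeasure (weight_measure \<omega>) (Q_box I)"
    using \<open>qbox (a, b) \<subseteq> Q_box I\<close> I
    by (intro emeasure_mono borel_subset_uhp_in_sets_weight_measure Q_box_borel Q_box_subset_uhp)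
  also have "\<dots> = wmeasure \<omega> (Q_box I)"
    by (intro wmeasure_eq[symmetric] w Q_box_borel I Q_box_subset_uhp)
  finally have le: "emeasure (weight_measure \<omega>) R \<le> wmeasure \<omega> (Q_box I)" .
  show thesis
  proof (rule that[of J])
    have "(\<lambda>n. emeasure (weight_measure \<omega>) (qbox (H n))) \<longlonglongrightarrow> emeasure (weight_measure \<omega>) R"
      unfolding R_def
    proof (intro Lim_emeasure_decseq image_subsetI qbox_in_sets_weight_measure)
      show "decseq (\<lambda>n. qbox (H n))" using H by (auto simp: decseq_def)
      show "emeasure (weight_measure \<omega>) (qbox (H n)) \<noteq> \<infinity>" for n using fin[of "H n"] by simp
    qed
    then have "(\<lambda>n. inverse (emeasure (weight_measure \<omega>) (qbox (H n)))) \<longlonglongrightarrow> inverse (emeasure (weight_measure \<omega>) R)"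
      by (intro continuous_on_tendsto_compose[OF continuous_on_inverse_ennreal[OF continuous_on_id[of UNIV]]]) auto
    moreover have "inverse (emeasure (weight_measure \<omega>) (qbox (H n))) \<le> (SUP n. inverse (emeasure (weight_measure \<omega>) (qbox (J n))))" for n
      by (intro SUP_upper2[of n] ennreal_inverse_antimono emeasure_mono J qbox_in_sets_weight_measure) auto
    ultimately have "inverse (emeasure (weight_measure \<omega>) R) \<le> (SUP n. inverse (emeasure (weight_measure \<omega>) (qbox (J n))))"
      by (intro LIMSEQ_le_const2) auto
    with ennreal_inverse_antimono[OF le]
    show "inverse (wmeasure \<omega> (Q_box I)) \<le> (SUP n. inverse (emeasure (weight_measure \<omega>) (qbox (J n))))"
      by (rule order_trans)
  qed (rule J)+
qed

text \<open>
  Approximating intervals from outside, rather than from inside, keeps the point \<open>z\<close> in the box when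
  it lies over an endpoint of \<open>I\<close>, and keeps a numerator that is merely monotone from dropping, as
  happens for \<open>\<mu>(Q\<^sub>I)\<close> when \<open>\<mu>\<close> charges the boundary.
\<close>

lemma SUP_intervals_eq_maxop:
  assumes w: "\<omega> \<in> borel_measurable (lebesgue_on uhp)"
    and fin: "\<And>J. emeasure (weight_measure \<omega>) (qbox J) < top"
    and mono: "\<And>I J. I \<in> intervals \<Longrightarrow> Q_box I \<subseteq> qbox J \<Longrightarrow> N (Q_box I) \<le> N (qbox J)"
  shows "(SUP I\<in>{I\<in>intervals. z \<in> Q_box I}. N (Q_box I) / wmeasure \<omega> (Q_box I))
    = maxop rat_intervals (\<lambda>J. N (qbox J) / emeasure (weight_measure \<omega>) (qbox J)) z" (is "?L = ?R")
proof (rule antisym)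
  show "?L \<le> ?R"
  proof (rule SUP_least)
    fix I assume "I \<in> {I\<in>intervals. z \<in> Q_box I}"
    then have I: "I \<in> intervals" "z \<in> Q_box I" by auto
    obtain J where J: "\<And>n::nat. J n \<in> rat_intervals" "\<And>n. Q_box I \<subseteq> qbox (J n)"
      "inverse (wmeasure \<omega> (Q_box I)) \<le> (SUP n. inverse (emeasure (weight_measure \<omega>) (qbox (J n))))"
      using weight_measure_Q_box[OF w I(1) fin] by blast
    have "N (Q_box I) / wmeasure \<omega> (Q_box I)
        \<le> N (Q_box I) * (SUP n. inverse (emeasure (weight_measure \<omega>) (qbox (J n))))"
      unfolding divide_ennreal_def by (intro mult_left_mono J) auto
    also have "\<dots> = (SUP n. N (Q_box I) / emeasure (weight_measure \<omega>) (qbox (J n)))"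
      unfolding divide_ennreal_def by (rule SUP_mult_left_ennreal)
    also have "\<dots> \<le> ?R"
    proof (rule SUP_least)
      fix n
      have "N (Q_box I) / emeasure (weight_measure \<omega>) (qbox (J n)) \<le> N (qbox (J n)) / emeasure (weight_measure \<omega>) (qbox (J n))"
        by (intro divide_right_mono_ennreal mono I J)
      also have "\<dots> \<le> ?R"
        using J I by (intro maxop_upper) auto
      finally show "N (Q_box I) / emeasure (weight_measure \<omega>) (qbox (J n)) \<le> ?R" .
    qed
    finally show "N (Q_box I) / wmeasure \<omega> (Q_box I) \<le> ?R" .
  qed
  show "?R \<le> ?L"
  proof (rule maxop_least)
    fix J assume J: "J \<in> rat_intervals" "z \<in> qbox J"
    then have *: "{fst J<..<snd J} \<in> intervals" "Q_box {fst J<..<snd J} = qbox J"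
      using greaterThanLessThan_in_intervals[of "fst J" "snd J"] by (auto simp: rat_intervals_def)
    have "wmeasure \<omega> (qbox J) = emeasure (weight_measure \<omega>) (qbox J)"
      by (intro wmeasure_eq w qbox_borel qbox_subset_uhp)
    then show "N (qbox J) / emeasure (weight_measure \<omega>) (qbox J) \<le> ?L"
      using * J by (intro SUP_upper2[of "{fst J<..<snd J}"]) auto
  qed
qed

lemma K_fun_eq_maxop:
  assumes w: "\<omega> \<in> borel_measurable (lebesgue_on uhp)"
    and fin: "\<And>J. emeasure (weight_measure \<omega>) (qbox J) < top"
    and mu: "\<And>I. qbox I \<in> sets \<mu>"
  shows "K_fun \<mu> \<omega> = maxop rat_intervals (\<lambda>J. emeasure \<mu> (qbox J) / emeasure (weight_measure \<omega>) (qbox J))"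
  unfolding K_fun_def by (intro ext SUP_intervals_eq_maxop w fin emeasure_mono mu)

lemma maximal_fun_eq_maxop:
  assumes w: "\<omega> \<in> borel_measurable (lebesgue_on uhp)"
    and fin: "\<And>J. emeasure (weight_measure \<omega>) (qbox J) < top"
    and f: "f \<in> borel_measurable (lebesgue_on uhp)"
  shows "maximal_fun \<omega> f = maxop rat_intervals
    (\<lambda>J. (\<integral>\<^sup>+z\<in>qbox J. ennreal (cmod (f z)) \<partial>weight_measure \<omega>) / emeasure (weight_measure \<omega>) (qbox J))"
proof
  fix z
  define N where "N A = (\<integral>\<^sup>+w\<in>A. ennreal (cmod (f w)) * ennreal (\<omega> w) \<partial>lebesgue)" for A
  have N_qbox: "N (qbox J) = (\<integral>\<^sup>+z\<in>qbox J. ennreal (cmod (f z)) \<partial>weight_measure \<omega>)" for J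
    unfolding N_def using f
    by (intro set_nn_integral_eq_weight_measure w qbox_borel qbox_subset_uhp) measurable
  have "maximal_fun \<omega> f z = maxop rat_intervals (\<lambda>J. N (qbox J) / emeasure (weight_measure \<omega>) (qbox J)) z"
    unfolding maximal_fun_def N_def
    by (intro SUP_intervals_eq_maxop w fin nn_integral_mono mult_left_mono) (auto simp: indicator_def)
  then show "maximal_fun \<omega> f z = maxop rat_intervals
    (\<lambda>J. (\<integral>\<^sup>+z\<in>qbox J. ennreal (cmod (f z)) \<partial>weight_measure \<omega>) / emeasure (weight_measure \<omega>) (qbox J)) z"
    by (simp add: N_qbox)
qed

section \<open>Doubling of Bekolle-Bonami weights\<close>

definition dual_weight :: "real \<Rightarrow> (complex \<Rightarrow> real) \<Rightarrow> complex \<Rightarrow> ennreal" where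
  "dual_weight p \<omega> z = epowr (ennreal (\<omega> z)) (1 - conj_exp p)"

lemma dual_weight_nonzero:
  assumes "1 < p"
  shows "dual_weight p \<omega> z \<noteq> 0"
  using assms by (auto simp: dual_weight_def epowr_def conj_exp_def field_simps enn2real_eq_0_iff)

lemma dual_weight_top:
  assumes "1 < p" "\<omega> z \<le> 0"
  shows "dual_weight p \<omega> z = top"
  using assms by (simp add: dual_weight_def epowr_def conj_exp_def ennreal_neg field_simps)

lemma Bp_const_ge:
  assumes w: "\<omega> \<in> borel_measurable (lebesgue_on uhp)" and I: "fst I < snd I"
  shows "emeasure (weight_measure \<omega>) (qbox I) / emeasure lebesgue (qbox I)
      * epowr ((\<integral>\<^sup>+z\<in>qbox I. dual_weight p \<omega> z \<partial>lebesgue) / emeasure lebesgue (qbox I)) (p - 1)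
    \<le> Bp_const p \<omega>"
proof -
  have *: "{fst I<..<snd I} \<in> intervals" "Q_box {fst I<..<snd I} = qbox I"
    using greaterThanLessThan_in_intervals[OF I] by simp_all
  have "(\<integral>\<^sup>+z\<in>qbox I. ennreal (\<omega> z) \<partial>lebesgue) = emeasure (weight_measure \<omega>) (qbox I)"
    using wmeasure_eq[OF w qbox_borel qbox_subset_uhp] by (simp add: wmeasure_def)
  then show ?thesis
    unfolding Bp_const_def using *
    by (intro SUP_upper2[of "{fst I<..<snd I}"]) (simp_all add: dual_weight_def)
qed

lemma measurable_times_indicator_qbox:
  assumes F: "F \<in> borel_measurable (lebesgue_on uhp)"
  shows "(\<lambda>z. F z * indicator (qbox I) z :: ennreal) \<in> borel_measurable lebesgue"
proof -
  have "(\<lambda>z. F z * indicator uhp z) \<in> borel_measurable lebesgue"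
    by (rule borel_measurable_restrict_space_iff_ennreal[THEN iffD1, OF _ F]) simp
  then have "(\<lambda>z. F z * indicator uhp z * indicator (qbox I) z) \<in> borel_measurable lebesgue"
    by (rule borel_measurable_times_ennreal[OF _ borel_measurable_indicator]) auto
  also have "(\<lambda>z. F z * indicator uhp z * indicator (qbox I) z) = (\<lambda>z. F z * indicator (qbox I) z)"
    using qbox_subset_uhp[of I] by (intro ext) (auto simp: indicator_def)
  finally show ?thesis .
qed

locale Bp_weight =
  fixes p :: real and \<omega> :: "complex \<Rightarrow> real"
  assumes p: "1 < p" and w: "\<omega> \<in> borel_measurable (lebesgue_on uhp)" and Bp: "Bp_const p \<omega> < top"
begin

lemma dual_weight_measurable: "dual_weight p \<omega> \<in> borel_measurable (lebesgue_on uhp)"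
  unfolding dual_weight_def[abs_def] using w by measurable

definition dual_mass :: "real \<times> real \<Rightarrow> ennreal" where
  "dual_mass I = (\<integral>\<^sup>+z\<in>qbox I. dual_weight p \<omega> z \<partial>lebesgue)"

lemma dual_mass_mono: "qbox I \<subseteq> qbox J \<Longrightarrow> dual_mass I \<le> dual_mass J"
  unfolding dual_mass_def by (intro nn_integral_mono mult_left_mono) (auto simp: indicator_def)

lemma dual_mass_nonzero:
  assumes "fst I < snd I"
  shows "dual_mass I \<noteq> 0"
proof
  assume "dual_mass I = 0"
  then have "AE z in lebesgue. dual_weight p \<omega> z * indicator (qbox I) z = 0"
    unfolding dual_mass_def
    by (subst (asm) nn_integral_0_iff_AE) (auto intro: measurable_times_indicator_qbox dual_weight_measurable)
  then have "AE z in lebesgue. z \<notin> qbox I"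
    by eventually_elim (use dual_weight_nonzero[OF p] in \<open>auto simp: indicator_def split: if_splits\<close>)
  then have "emeasure lebesgue (qbox I) = 0"
    by (subst (asm) AE_iff_measurable[of "qbox I"]) auto
  then show False using assms by (simp add: emeasure_qbox)
qed

lemma product_finite:
  assumes I: "fst I < snd I"
  shows "emeasure (weight_measure \<omega>) (qbox I) / emeasure lebesgue (qbox I)
      * epowr (dual_mass I / emeasure lebesgue (qbox I)) (p - 1) < top"
  using Bp_const_ge[OF w I, of p] Bp unfolding dual_mass_def by (rule le_less_trans)

text \<open>
  As \<open>\<omega>\<close> takes real values, \<open>\<omega>\<^bsup>1-p'\<^esup>\<close> vanishes nowhere and has positive mass on every box. An
  infinite mass of \<open>\<omega>\<close> would therefore make the \<open>B\<^sub>p\<close> product infinite.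
\<close>

lemma emeasure_qbox_finite: "emeasure (weight_measure \<omega>) (qbox I) < top"
proof (cases "fst I < snd I")
  case True
  show ?thesis
  proof (rule ccontr)
    assume "\<not> ?thesis"
    then have "emeasure (weight_measure \<omega>) (qbox I) = top" by (simp add: less_top[symmetric])
    with product_finite[OF True] dual_mass_nonzero[OF True] p True show False
      by (simp add: emeasure_qbox ennreal_top_divide ennreal_top_mult)
  qed
next
  case False
  then have "qbox I = {}" by (auto simp: qbox_def)
  then show ?thesis by simp
qed

lemma dual_mass_finite:
  assumes I: "fst I < snd I" "emeasure (weight_measure \<omega>) (qbox I) \<noteq> 0"
  shows "dual_mass I < top"
proof (rule ccontr)
  assume "\<not> ?thesis"
  then have "dual_mass I = top" by (simp add: less_top[symmetric])
  with product_finite[OF I(1)] I p show False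
    by (simp add: emeasure_qbox ennreal_top_divide ennreal_mult_top)
qed

lemma AE_weight_pos:
  assumes I: "fst I < snd I" "emeasure (weight_measure \<omega>) (qbox I) \<noteq> 0"
  shows "AE z in lebesgue. z \<in> qbox I \<longrightarrow> 0 < \<omega> z"
proof -
  have "AE z in lebesgue. dual_weight p \<omega> z * indicator (qbox I) z \<noteq> \<infinity>"
    using dual_mass_finite[OF I] unfolding dual_mass_def
    by (intro nn_integral_PInf_AE measurable_times_indicator_qbox dual_weight_measurable) auto
  then show ?thesis
  proof eventually_elim
    case (elim z)
    then show ?case using dual_weight_top[OF p, of \<omega> z] by (cases "\<omega> z \<le> 0") auto
  qed
qed

text \<open>
  On a box of positive \<open>\<nu>\<close>-measure, \<open>\<omega>\<^bsup>1-p'\<^esup>\<close> is integrable and so \<open>\<omega>\<close> is positive almost everywhere.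
  Applied to a box containing two given nondegenerate ones, this excludes that \<open>\<nu>\<close> vanishes on
  exactly one of them.
\<close>

lemma emeasure_qbox_eq_0:
  assumes I: "fst I < snd I" "emeasure (weight_measure \<omega>) (qbox I) = 0"
  shows "emeasure (weight_measure \<omega>) (qbox J) = 0"
proof (cases "fst J < snd J")
  case True
  define L where "L = (min (fst I) (fst J), max (snd I) (snd J))"
  have L: "fst L < snd L" "qbox I \<subseteq> qbox L" "qbox J \<subseteq> qbox L"
    using I True qbox_mono[of L I] qbox_mono[of L J] by (simp_all add: L_def)
  have "emeasure (weight_measure \<omega>) (qbox L) = 0"
  proof (rule ccontr)
    assume "emeasure (weight_measure \<omega>) (qbox L) \<noteq> 0"
    from AE_weight_pos[OF L(1) this] have "AE z in lebesgue. z \<in> qbox I \<longrightarrow> 0 < \<omega> z"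
      by eventually_elim (use L in auto)
    moreover have "(\<integral>\<^sup>+z. ennreal (\<omega> z) * indicator (qbox I) z \<partial>lebesgue) = 0"
      using I(2) wmeasure_eq[OF w qbox_borel[of I] qbox_subset_uhp] by (simp add: wmeasure_def)
    then have "AE z in lebesgue. ennreal (\<omega> z) * indicator (qbox I) z = 0"
      by (subst (asm) nn_integral_0_iff_AE) (use w in \<open>auto intro: measurable_times_indicator_qbox\<close>)
    ultimately have "AE z in lebesgue. z \<notin> qbox I"
      by eventually_elim (auto simp: indicator_def split: if_splits)
    then have "emeasure lebesgue (qbox I) = 0"
      by (subst (asm) AE_iff_measurable[of "qbox I"]) auto
    then show False using I by (simp add: emeasure_qbox)
  qed
  with emeasure_mono[OF L(3) qbox_in_sets_weight_measure, of \<omega>] show ?thesis by simp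
next
  case False
  then have "qbox J = {}" by (auto simp: qbox_def)
  then show ?thesis by simp
qed

text \<open>
  Hoelder's inequality for \<open>1 = \<omega>\<^bsup>1/p\<^esup> (\<omega>\<^bsup>1-p'\<^esup>)\<^bsup>1/p'\<^esup>\<close>, raised to the power \<open>p\<close>. It is the reverse of the
  \<open>B\<^sub>p\<close> condition.
\<close>

lemma volume_le:
  assumes I: "fst I < snd I" "emeasure (weight_measure \<omega>) (qbox I) \<noteq> 0"
  shows "epowr (emeasure lebesgue (qbox I)) p \<le> emeasure (weight_measure \<omega>) (qbox I) * epowr (dual_mass I) (p - 1)"
proof -
  define p' where "p' = p / (p - 1)"
  have p': "1 < p'" "1 / p + 1 / p' = 1" "1 / p' * p = p - 1"
    using p by (auto simp: p'_def field_simps)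
  define u where "u z = epowr (ennreal (\<omega> z)) (1 / p) * indicator (qbox I) z" for z
  define v where "v z = epowr (dual_weight p \<omega> z) (1 / p') * indicator (qbox I) z" for z
  have [measurable]: "\<omega> \<in> borel_measurable (lebesgue_on uhp)"
    "dual_weight p \<omega> \<in> borel_measurable (lebesgue_on uhp)"
    by (rule w dual_weight_measurable)+
  have meas: "u \<in> borel_measurable lebesgue" "v \<in> borel_measurable lebesgue"
    unfolding u_def[abs_def] v_def[abs_def] by (intro measurable_times_indicator_qbox; measurable)+
  have "emeasure lebesgue (qbox I) = (\<integral>\<^sup>+z. indicator (qbox I) z \<partial>lebesgue)"
    by simp
  also have "\<dots> \<le> (\<integral>\<^sup>+z. u z * v z \<partial>lebesgue)"
  proof (rule nn_integral_mono_AE)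
    show "AE z in lebesgue. indicator (qbox I) z \<le> u z * v z"
      using AE_weight_pos[OF I]
    proof eventually_elim
      case (elim z)
      show ?case
      proof (cases "z \<in> qbox I")
        case True
        with elim have pos: "0 < \<omega> z" by blast
        have e: "1 - conj_exp p = - (1 / (p - 1))" "1 / (p - 1) * (1 / p') = 1 / p"
          using p by (auto simp: conj_exp_def p'_def field_simps)
        have "epowr (dual_weight p \<omega> z) (1 / p') = ennreal ((\<omega> z powr (1 - conj_exp p)) powr (1 / p'))"
          using pos p p' by (simp add: dual_weight_def epowr_def conj_exp_def ennreal_eq_0_iff)
        also have "(\<omega> z powr (1 - conj_exp p)) powr (1 / p') = \<omega> z powr (- (1 / p))"
          unfolding powr_powr e(1) using e(2) by simp
        finally have "u z * v z = ennreal (\<omega> z powr (1 / p) * \<omega> z powr (- (1 / p)))"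
          using True pos p by (simp add: u_def v_def epowr_ennreal ennreal_mult[symmetric])
        also have "\<dots> = 1"
          using pos by (simp add: powr_add[symmetric])
        finally show ?thesis using True by simp
      qed (simp add: u_def v_def)
    qed
  qed
  also have "\<dots> \<le> epowr (\<integral>\<^sup>+z. epowr (u z) p \<partial>lebesgue) (1 / p) * epowr (\<integral>\<^sup>+z. epowr (v z) p' \<partial>lebesgue) (1 / p')"
    by (intro nn_integral_Hoelder p p' meas)
  also have "(\<integral>\<^sup>+z. epowr (u z) p \<partial>lebesgue) = (\<integral>\<^sup>+z. ennreal (\<omega> z) * indicator (qbox I) z \<partial>lebesgue)"
    using p by (intro nn_integral_cong) (auto simp: u_def epowr_epowr indicator_def)
  also have "\<dots> = emeasure (weight_measure \<omega>) (qbox I)"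
    using wmeasure_eq[OF w qbox_borel[of I] qbox_subset_uhp] by (simp add: wmeasure_def)
  also have "(\<integral>\<^sup>+z. epowr (v z) p' \<partial>lebesgue) = dual_mass I"
    unfolding dual_mass_def
    using p' by (intro nn_integral_cong) (auto simp: v_def epowr_epowr indicator_def)
  finally have "epowr (emeasure lebesgue (qbox I)) p
      \<le> epowr (epowr (emeasure (weight_measure \<omega>) (qbox I)) (1 / p) * epowr (dual_mass I) (1 / p')) p"
    using p by (intro epowr_mono) auto
  also have "\<dots> = emeasure (weight_measure \<omega>) (qbox I) * epowr (dual_mass I) (p - 1)"
    using p p' by (simp add: epowr_mult epowr_epowr)
  finally show ?thesis .
qed

text \<open>
  Compare the \<open>B\<^sub>p\<close> condition on the triple of \<open>I\<close> with its reverse on \<open>I\<close>: the dual mass grows with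
  the box and cancels, and what remains is the \<open>p\<close>-th power of the quotient \<open>9\<close> of the areas.
\<close>

lemma doubling_weight_measure:
  assumes nz: "\<And>I. fst I < snd I \<Longrightarrow> emeasure (weight_measure \<omega>) (qbox I) \<noteq> 0"
  shows "emeasure (weight_measure \<omega>) (qbox (triple I)) \<le> Bp_const p \<omega> * ennreal (9 powr p) * emeasure (weight_measure \<omega>) (qbox I)"
proof (cases "fst I < snd I")
  case False
  then have "qbox (triple I) = {}" by (auto simp: qbox_def triple_def)
  then show ?thesis by simp
next
  case I: True
  define L where "L = triple I"
  have L: "fst L < snd L" "qbox I \<subseteq> qbox L"
    using I qbox_mono[of L I] by (simp_all add: L_def triple_def)
  define V where "V = (snd I - fst I)\<^sup>2"
  have V: "0 < V" "emeasure lebesgue (qbox I) = ennreal V" "emeasure lebesgue (qbox L) = ennreal (9 * V)"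
    using I power_mult_distrib[of 3 "snd I - fst I" 2]
    by (simp_all add: V_def emeasure_qbox L_def triple_def algebra_simps)
  define A B S where "A = emeasure (weight_measure \<omega>) (qbox I)" and "B = emeasure (weight_measure \<omega>) (qbox L)"
    and "S = epowr (dual_mass L) (p - 1)"
  have split: "dual_mass L = (dual_mass L / ennreal (9 * V)) * ennreal (9 * V)"
    "B = (B / ennreal (9 * V)) * ennreal (9 * V)"
    using V(1) by (simp_all add: ennreal_divide_times ennreal_eq_0_iff)
  have "B * S = (B / ennreal (9 * V) * epowr (dual_mass L / ennreal (9 * V)) (p - 1))
      * (ennreal (9 * V) * epowr (ennreal (9 * V)) (p - 1))"
    unfolding S_def by (subst split(1), subst split(2), subst epowr_mult) (use p in \<open>auto simp: mult_ac\<close>)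
  also have "\<dots> \<le> Bp_const p \<omega> * (ennreal (9 * V) * epowr (ennreal (9 * V)) (p - 1))"
    using Bp_const_ge[OF w L(1), of p] unfolding B_def dual_mass_def V(3) by (rule mult_right_mono) simp
  also have "ennreal (9 * V) * epowr (ennreal (9 * V)) (p - 1) = ennreal (9 powr p) * ennreal (V powr p)"
    using V(1) p by (simp add: epowr_ennreal ennreal_mult[symmetric] powr_mult powr_diff)
  finally have BS: "B * S \<le> Bp_const p \<omega> * (ennreal (9 powr p) * ennreal (V powr p))" .
  have "ennreal (V powr p) \<le> A * epowr (dual_mass I) (p - 1)"
    using volume_le[OF I nz[OF I]] V p by (simp add: A_def epowr_ennreal)
  also have "\<dots> \<le> A * S"
    unfolding S_def using p by (intro mult_left_mono epowr_mono dual_mass_mono L) auto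
  finally have "ennreal (V powr p) * B \<le> A * S * B"
    by (rule mult_right_mono) simp
  also have "\<dots> = A * (B * S)" by (simp add: mult_ac)
  also have "\<dots> \<le> A * (Bp_const p \<omega> * (ennreal (9 powr p) * ennreal (V powr p)))"
    by (intro mult_left_mono BS) simp
  finally have "ennreal (V powr p) * B \<le> ennreal (V powr p) * (Bp_const p \<omega> * ennreal (9 powr p) * A)"
    by (simp add: mult_ac)
  then have "B \<le> Bp_const p \<omega> * ennreal (9 powr p) * A"
    using V(1) by (subst (asm) ennreal_mult_le_mult_iff) auto
  then show ?thesis by (simp add: A_def B_def L_def)
qed

end

section \<open>The characterisation\<close>

theorem theorem1p2:
  fixes p q s :: real and \<omega> :: "complex \<Rightarrow> real" and \<mu> :: "complex measure"
  assumes "1 < q" and "q < p"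
    and "weight \<omega>" and "\<omega> \<in> Bp_class p"
    and "space \<mu> = uhp" and "sets \<mu> = sets (restrict_space borel uhp)"
    and "s = p / (p - q)"
  shows "(\<exists>C\<^sub>1::real. C\<^sub>1 > 0 \<and>
            (\<forall>f\<in>L_space p \<omega>.
               epowr (\<integral>\<^sup>+z. epowr (maximal_fun \<omega> f z) q \<partial>\<mu>) (1 / q)
                 \<le> ennreal C\<^sub>1 * wnorm p \<omega> (\<lambda>z. ennreal (cmod (f z)))))
         \<longleftrightarrow> K_fun \<mu> \<omega> \<in> L_space_ext s \<omega>"
proof -
  note pq = assms(1,2,7)
  define \<nu> where "\<nu> = weight_measure \<omega>"
  have pos: "0 < p" "0 < q" "0 < s" using pq(1,2) by (simp_all add: pq(3))
  have w: "\<omega> \<in> borel_measurable (lebesgue_on uhp)"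
    by (rule weight_measurable assms)+
  interpret Bp_weight p \<omega>
    using assms w by unfold_locales (auto simp: Bp_class_def)
  have mu_sets: "qbox I \<in> sets \<mu>" for I
    using qbox_subset_uhp[of I] by (auto simp: assms(6) sets_restrict_space_iff)
  have K_eq: "K_fun \<mu> \<omega> = maxop rat_intervals (\<lambda>J. emeasure \<mu> (qbox J) / emeasure \<nu> (qbox J))"
    unfolding \<nu>_def by (intro K_fun_eq_maxop w emeasure_qbox_finite mu_sets)
  have M_eq: "maximal_fun \<omega> f = maxop rat_intervals
      (\<lambda>J. (\<integral>\<^sup>+z\<in>qbox J. ennreal (cmod (f z)) \<partial>\<nu>) / emeasure \<nu> (qbox J))"
    if "f \<in> borel_measurable (lebesgue_on uhp)" for f
    unfolding \<nu>_def using that by (intro maximal_fun_eq_maxop w emeasure_qbox_finite)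
  have meas_nu: "borel_measurable \<nu> = (borel_measurable (lebesgue_on uhp) :: (complex \<Rightarrow> ennreal) set)"
    unfolding \<nu>_def by (intro measurable_cong_sets sets_weight_measure refl)
  have K_meas: "K_fun \<mu> \<omega> \<in> borel_measurable \<nu>"
    unfolding K_eq unfolding \<nu>_def
    by (intro borel_measurable_maxop countable_rat_intervals qbox_in_sets_weight_measure)
  have wnorm_nu: "wnorm r \<omega> F = epowr (\<integral>\<^sup>+z. epowr (F z) r \<partial>\<nu>) (1 / r)"
    if "F \<in> borel_measurable \<nu>" for F r
    using that wnorm_eq[OF w] by (simp add: meas_nu \<nu>_def[symmetric])
  have K_iff: "K_fun \<mu> \<omega> \<in> L_space_ext s \<omega> \<longleftrightarrow> (\<integral>\<^sup>+z. epowr (K_fun \<mu> \<omega> z) s \<partial>\<nu>) < top"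
    using K_meas pos by (simp add: L_space_ext_def wnorm_nu meas_nu)
  have L_iff: "f \<in> L_space p \<omega> \<longleftrightarrow> f \<in> borel_measurable (lebesgue_on uhp)
      \<and> (\<integral>\<^sup>+z. epowr (ennreal (cmod (f z))) p \<partial>\<nu>) < top" for f
  proof -
    have "(\<lambda>z. ennreal (cmod (f z))) \<in> borel_measurable \<nu>" if "f \<in> borel_measurable (lebesgue_on uhp)"
      using that unfolding meas_nu by measurable
    then show ?thesis
      using pos by (auto simp: L_space_def wnorm_nu)
  qed
  show ?thesis
  proof (cases "\<exists>I. fst I < snd I \<and> emeasure \<nu> (qbox I) = 0")
    case True
    \<comment> \<open>The weight vanishes almost everywhere: all averages are \<open>0 / 0 = 0\<close>, and every function has norm
      \<open>0\<close>.\<close>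
    then have zero: "emeasure \<nu> (qbox J) = 0" for J
      using emeasure_qbox_eq_0 unfolding \<nu>_def by blast
    have int_zero: "(\<integral>\<^sup>+z. F z \<partial>\<nu>) = 0" for F
      using zero by (intro nn_integral_eq_0_if_qbox_null) (simp_all add: \<nu>_def space_weight_measure qbox_in_sets_weight_measure)
    have "maximal_fun \<omega> f z = 0" if "f \<in> L_space p \<omega>" for f z
      using that maxop_least[of rat_intervals z _ 0] by (auto simp: L_iff M_eq int_zero)
    then have "\<forall>f\<in>L_space p \<omega>. epowr (\<integral>\<^sup>+z. epowr (maximal_fun \<omega> f z) q \<partial>\<mu>) (1 / q)
        \<le> ennreal 1 * wnorm p \<omega> (\<lambda>z. ennreal (cmod (f z)))"
      using pos by simp
    then show ?thesis
      unfolding K_iff int_zero by (auto intro!: exI[of _ 1])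
  next
    case False
    then have nz: "fst I < snd I \<Longrightarrow> emeasure \<nu> (qbox I) \<noteq> 0" for I by blast
    interpret qbox_doubling \<nu> "Bp_const p \<omega> * ennreal (9 powr p)"
    proof
      show "Bp_const p \<omega> * ennreal (9 powr p) < top"
        using Bp by (simp add: ennreal_mult_less_top)
    qed (use nz doubling_weight_measure emeasure_qbox_finite in
        \<open>auto simp: \<nu>_def space_weight_measure qbox_in_sets_weight_measure zero_less_iff_neq_zero\<close>)
    have K_ratio: "K_fun \<mu> \<omega> = maxop rat_intervals (ratio \<mu>)"
      unfolding K_eq ratio_def[abs_def] ..
    have M_average: "maximal_fun \<omega> f = maxop rat_intervals (average (\<lambda>z. ennreal (cmod (f z))))"
      if "f \<in> borel_measurable (lebesgue_on uhp)" for f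
      unfolding M_eq[OF that] average_def[abs_def] ..
    show ?thesis unfolding K_iff
    proof
      assume "\<exists>C\<^sub>1>0. \<forall>f\<in>L_space p \<omega>. epowr (\<integral>\<^sup>+z. epowr (maximal_fun \<omega> f z) q \<partial>\<mu>) (1 / q)
          \<le> ennreal C\<^sub>1 * wnorm p \<omega> (\<lambda>z. ennreal (cmod (f z)))"
      then obtain C\<^sub>1 :: real where C1: "C\<^sub>1 > 0" "\<And>f. f \<in> L_space p \<omega> \<Longrightarrow>
          epowr (\<integral>\<^sup>+z. epowr (maximal_fun \<omega> f z) q \<partial>\<mu>) (1 / q)
          \<le> ennreal C\<^sub>1 * wnorm p \<omega> (\<lambda>z. ennreal (cmod (f z)))" by blast
      show "(\<integral>\<^sup>+z. epowr (K_fun \<mu> \<omega> z) s \<partial>\<nu>) < top"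
        unfolding K_ratio
      proof (rule ratio_in_L_if_embedding[OF pq assms(5) mu_sets])
        show "epowr (ennreal C\<^sub>1) q < top" using pos by simp
        fix g :: "complex \<Rightarrow> ennreal"
        assume g: "g \<in> borel_measurable \<nu>" "\<And>z. g z < top" "(\<integral>\<^sup>+z. epowr (g z) p \<partial>\<nu>) < top"
        \<comment> \<open>The maximal function only sees \<open>|f|\<close>, so finite nonnegative functions serve as test functions.\<close>
        define f where "f z = complex_of_real (enn2real (g z))" for z
        have g_eq: "ennreal (cmod (f z)) = g z" for z
          using g(2)[of z] by (simp add: f_def)
        have f_meas: "f \<in> borel_measurable (lebesgue_on uhp)"
          using g(1) unfolding f_def[abs_def] meas_nu by measurable
        have "f \<in> L_space p \<omega>"
          unfolding L_iff using f_meas g(3) by (simp add: g_eq)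
        from C1(2)[OF this]
        have "epowr (\<integral>\<^sup>+z. epowr (maxop rat_intervals (average g) z) q \<partial>\<mu>) (1 / q)
            \<le> ennreal C\<^sub>1 * epowr (\<integral>\<^sup>+z. epowr (g z) p \<partial>\<nu>) (1 / p)"
          by (simp add: M_average[OF f_meas] g_eq wnorm_nu g(1))
        then have "(\<integral>\<^sup>+z. epowr (maxop rat_intervals (average g) z) q \<partial>\<mu>)
            \<le> epowr (ennreal C\<^sub>1 * epowr (\<integral>\<^sup>+z. epowr (g z) p \<partial>\<nu>) (1 / p)) q"
          using pos by (subst (asm) epowr_le_iff) auto
        also have "\<dots> = epowr (ennreal C\<^sub>1) q * epowr (\<integral>\<^sup>+z. epowr (g z) p \<partial>\<nu>) (q / p)"
          using pos by (simp add: epowr_mult epowr_epowr)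
        finally show "(\<integral>\<^sup>+z. epowr (maxop rat_intervals (average g) z) q \<partial>\<mu>)
            \<le> epowr (ennreal C\<^sub>1) q * epowr (\<integral>\<^sup>+z. epowr (g z) p \<partial>\<nu>) (q / p)" .
      qed
    next
      assume K_fin: "(\<integral>\<^sup>+z. epowr (K_fun \<mu> \<omega> z) s \<partial>\<nu>) < top"
      have ratio_le: "ratio \<mu> I \<le> K_fun \<mu> \<omega> z" if I: "fst I < snd I" "z \<in> qbox I" for I z
      proof -
        have *: "{fst I<..<snd I} \<in> intervals" "Q_box {fst I<..<snd I} = qbox I"
          using greaterThanLessThan_in_intervals[OF I(1)] by simp_all
        have "wmeasure \<omega> (qbox I) = emeasure \<nu> (qbox I)"
          unfolding \<nu>_def by (intro wmeasure_eq w qbox_borel qbox_subset_uhp)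
        then show ?thesis
          unfolding K_fun_def ratio_def using * I by (intro SUP_upper2[of "{fst I<..<snd I}"]) auto
      qed
      \<comment> \<open>If a box had infinite mass, \<open>K\<^sub>\<mu>\<close> would be infinite on it.\<close>
      have fin: "emeasure \<mu> (qbox I) < top" for I
      proof (rule ccontr)
        assume "\<not> ?thesis"
        then have top: "emeasure \<mu> (qbox I) = top" by (simp add: less_top[symmetric])
        then have "qbox I \<noteq> {}" by auto
        then have I: "fst I < snd I" by (auto simp: qbox_def)
        have "ratio \<mu> I = top"
          using top qbox_finite[of I] by (simp add: ratio_def ennreal_top_divide)
        with ratio_le[OF I] have "K_fun \<mu> \<omega> z = top" if "z \<in> qbox I" for z
          using that by (simp add: top_unique)
        then have "(\<integral>\<^sup>+z. top * indicator (qbox I) z \<partial>\<nu>) \<le> (\<integral>\<^sup>+z. epowr (K_fun \<mu> \<omega> z) s \<partial>\<nu>)"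
          using pos by (intro nn_integral_mono) (auto simp: indicator_def)
        then have "top * emeasure \<nu> (qbox I) \<le> (\<integral>\<^sup>+z. epowr (K_fun \<mu> \<omega> z) s \<partial>\<nu>)"
          by (simp only: nn_integral_cmult_indicator[OF qbox_sets])
        then show False
          using K_fin qbox_pos[OF I] by (auto simp: ennreal_top_mult top_unique split: if_splits)
      qed
      define A where "A = Bp_const p \<omega> * ennreal (9 powr p) * epowr (\<integral>\<^sup>+z. epowr (K_fun \<mu> \<omega> z) s \<partial>\<nu>) (1 / s)
          * epowr (Bp_const p \<omega> * ennreal (9 powr p) * ennreal (p / (p - 1))) q"
      \<comment> \<open>The constant will be \<open>B + 1\<close>, because \<open>B\<close> may be \<open>0\<close>.\<close>
      define B where "B = epowr A (1 / q)"
      have "B < top"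
        using Bp K_fin pos by (simp add: A_def B_def ennreal_mult_less_top)
      have "epowr (\<integral>\<^sup>+z. epowr (maximal_fun \<omega> f z) q \<partial>\<mu>) (1 / q)
          \<le> ennreal (enn2real B + 1) * wnorm p \<omega> (\<lambda>z. ennreal (cmod (f z)))" if "f \<in> L_space p \<omega>" for f
      proof -
        have f: "f \<in> borel_measurable (lebesgue_on uhp)" "(\<lambda>z. ennreal (cmod (f z))) \<in> borel_measurable \<nu>"
          "(\<integral>\<^sup>+z. epowr (ennreal (cmod (f z))) p \<partial>\<nu>) < top"
          using that unfolding L_iff meas_nu by auto
        have "epowr (\<integral>\<^sup>+z. epowr (maximal_fun \<omega> f z) q \<partial>\<mu>) (1 / q)
            \<le> epowr (A * epowr (\<integral>\<^sup>+z. epowr (ennreal (cmod (f z))) p \<partial>\<nu>) (q / p)) (1 / q)"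
          unfolding M_average[OF f(1)] A_def using pos
          by (intro epowr_mono embedding_if_ratio_in_L pq assms mu_sets fin K_meas ratio_le f) auto
        also have "\<dots> = B * wnorm p \<omega> (\<lambda>z. ennreal (cmod (f z)))"
          using pos by (simp add: B_def wnorm_nu f(2) epowr_mult epowr_epowr)
        also have "\<dots> \<le> ennreal (enn2real B + 1) * wnorm p \<omega> (\<lambda>z. ennreal (cmod (f z)))"
        proof (rule mult_right_mono)
          have "B = ennreal (enn2real B)" using \<open>B < top\<close> by simp
          also have "\<dots> \<le> ennreal (enn2real B + 1)" by (intro ennreal_leI) simp
          finally show "B \<le> ennreal (enn2real B + 1)" .
        qed simp
        finally show ?thesis .
      qed
      moreover have "enn2real B + 1 > 0" by (simp add: add_nonneg_pos)
      ultimately show "\<exists>C\<^sub>1>0. \<forall>f\<in>L_space p \<omega>. epowr (\<integral>\<^sup>+z. epowr (maximal_fun \<omega> f z) q \<partial>\<mu>) (1 / q)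
          \<le> ennreal C\<^sub>1 * wnorm p \<omega> (\<lambda>z. ennreal (cmod (f z)))" by blast
    qed
  qed
qed

end
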